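(* Fix $\ell \in \mathbb{N}$ and set $n = \ell m - 1$ with $m \in \mathbb{N}\setminus\{1\}$. Let $$T_n(x) = \sum_{j=0}^{n} \big( a_j \cos(jx) + b_j \sin(jx) \big), \quad x \in (0,2\pi).$$ Assume that $\{a_i\}_{i=0}^{\ell-1} \cup \{b_i\}_{i=0}^{\ell-1}$ is a family of i.i.d. random variables with Gaussian distribution $\mathcal{N}(0,\sigma^2)$, $\sigma > 0$, and that the coefficients $a_0,\dots,a_n$ and $b_0,\dots,b_n$ are $\ell$-periodic. Then $$\mathbb{E}[N_n(0,2\pi)] = n + 1 - \ell + \sqrt{n^2 + \frac{\ell^2 - 1}{3}}.$$
   Context: $\mathbb{N} = \{1,2,3,\dots\}$. A finite sequence $c_0, c_1, \dots, c_n$ is called $\ell$-periodic if $c_{i+\ell} = c_i$ for all $0 \le i \le n-\ell$. $N_n(0,2\pi)$ denotes the (random) number of real zeros of $T_n$ in the interval $(0,2\pi)$, and $\mathbb{E}$ denotes expectation. *)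

theory Defs
  imports "HOL-Probability.Probability"
begin

definition trig_poly :: "nat \<Rightarrow> (nat \<Rightarrow> real) \<Rightarrow> (nat \<Rightarrow> real) \<Rightarrow> real \<Rightarrow> real" where
  "trig_poly n a b x = (\<Sum>j\<le>n. a j * cos (real j * x) + b j * sin (real j * x))"

text \<open>Periodicity of the finite sequence \<open>c 0, \<dots>, c n\<close>; the values \<open>c i\<close> for \<open>i > n\<close> are
  not constrained. The condition \<open>i + l \<le> n\<close> stands for \<open>i \<le> n - l\<close> without truncated subtraction.\<close>

definition periodic_upto :: "nat \<Rightarrow> nat \<Rightarrow> (nat \<Rightarrow> 'b) \<Rightarrow> bool" where
  "periodic_upto l n c \<longleftrightarrow> (\<forall>i. i + l \<le> n \<longrightarrow> c (i + l) = c i)"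

definition zeros_on :: "real set \<Rightarrow> (real \<Rightarrow> real) \<Rightarrow> real set" where
  "zeros_on S f = {x \<in> S. f x = 0}"

text \<open>Zeros are counted without multiplicity. As \<open>card\<close> sends infinite sets to \<open>0\<close>, this is the
  number of zeros only when \<open>zeros_on S f\<close> is finite.\<close>

definition num_zeros :: "real set \<Rightarrow> (real \<Rightarrow> real) \<Rightarrow> nat" where
  "num_zeros S f = card (zeros_on S f)"

end

theory Submission
  imports Defs "HOL-Real_Asymp.Real_Asymp"
begin

text \<open>
  Put \<open>e j = l (m - 1) / 2 + j\<close>. Summing the polynomial over its \<open>m\<close> blocks of length
  \<open>l\<close>, in which the coefficients repeat, and centring the block index gives
  \<open>T x = D x * Y x\<close> with a deterministic \<open>D\<close> and the Gaussian sum
  \<open>Y x = (\<Sum>j<l. a j * cos (e j * x) + b j * sin (e j * x))\<close>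
  (\<open>trig_poly_periodic_factorization\<close>). Since \<open>D x = sin (l m x / 2) / sin (l x / 2)\<close>, the
  factor \<open>D\<close> has exactly \<open>l m - l = n + 1 - l\<close> zeros in \<open>(0, 2 pi)\<close>
  (\<open>card_dirichlet_factor_zeros\<close>), and almost surely none of them is a zero of \<open>Y\<close>.

  The zeros of \<open>Y\<close> account for the square root. The process \<open>Y\<close> is stationary and Gaussian,
  with covariance proportional to \<open>(\<Sum>j<l. cos (e j * h))\<close>, and the mean number of its zeros in
  \<open>(0, q)\<close> is \<open>q / pi\<close> times the quadratic mean of the frequencies \<open>e j\<close>, as Rice's formula
  predicts (\<open>expected_zeros\<close>). For \<open>q = 2 pi\<close> this is the root of
  \<open>n\<^sup>2 + (l\<^sup>2 - 1) / 3\<close>, because the \<open>e j\<close> are \<open>l\<close> points of spacing 1 centred at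
  \<open>n / 2\<close>.

  Rice's formula is obtained by counting sign changes of \<open>Y\<close> on the grid of mesh \<open>h = q / k\<close>.
  Two values \<open>Y x\<close> and \<open>Y (x + h)\<close> are distributed like \<open>A s\<close> and \<open>B s + C t\<close> with
  independent normal \<open>s\<close> and \<open>t\<close> (\<open>nn_integral_PiM_gauss_two_forms\<close>, which rests on the
  rotation invariance of a pair of independent normal variables). They have opposite signs with
  probability \<open>1 / pi\<close> times the angle between the two vectors of coefficients
  (\<open>emeasure_gauss_sector\<close>), and \<open>k\<close> times this probability tends to the claimed mean. The
  number of sign changes never exceeds the number of zeros, and it reaches that number on
  all fine grids as soon as every zero is simple and no grid point is a zero. Both happen almost
  surely (\<open>AE_no_double_zeros\<close>, \<open>AE_process_nonzero\<close>), so Fatou's lemma gives the equality of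
  the mean number of zeros and the limit.
\<close>

section \<open>Rotation invariance of the Gaussian measure\<close>

abbreviation gauss :: "real \<Rightarrow> real measure" where
  "gauss \<sigma> \<equiv> density lborel (\<lambda>x. ennreal (normal_density 0 \<sigma> x))"

lemma rotation_exists:
  fixes p q r :: real
  assumes "r\<^sup>2 = p\<^sup>2 + q\<^sup>2"
  shows "\<exists>c s. c\<^sup>2 + s\<^sup>2 = 1 \<and> p = r * c \<and> q = r * s"
proof (cases "r = 0")
  case True
  then have "p = 0" "q = 0" using assms by (auto simp: sum_power2_eq_zero_iff)
  then show ?thesis using True by (intro exI[of _ 1] exI[of _ 0]) auto
next
  case False
  have "(p / r)\<^sup>2 + (q / r)\<^sup>2 = (p\<^sup>2 + q\<^sup>2) / r\<^sup>2" by (simp add: power_divide add_divide_distrib)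
  also have "\<dots> = 1" using False assms by (metis divide_self_if power_eq_0_iff)
  finally show ?thesis using False by (intro exI[of _ "p / r"] exI[of _ "q / r"]) auto
qed

text \<open>For \<open>c \<noteq> 0\<close> a rotation is a map that alters only the first coordinate followed by a map
  that alters only the second one. One-dimensional affine substitutions and Tonelli's theorem treat
  each in turn, and the factors \<open>1 / c\<close> and \<open>c\<close> cancel. Working with iterated integrals avoids
  any change of variables in the plane.\<close>

lemma nn_integral_lborel_rotation:
  fixes f :: "real \<times> real \<Rightarrow> ennreal" and c s :: real
  assumes [measurable]: "f \<in> borel_measurable (borel \<Otimes>\<^sub>M borel)" and cs: "c\<^sup>2 + s\<^sup>2 = 1"
  shows "(\<integral>\<^sup>+x. \<integral>\<^sup>+y. f (c * x - s * y, s * x + c * y) \<partial>lborel \<partial>lborel) = (\<integral>\<^sup>+x. \<integral>\<^sup>+y. f (x, y) \<partial>lborel \<partial>lborel)"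
proof (cases "c = 0")
  case True
  then have s: "s = 1 \<or> s = -1" using cs by (simp add: power2_eq_1_iff)
  have s0: "s \<noteq> 0" and as: "\<bar>s\<bar> = 1" using s by auto
  have "(\<integral>\<^sup>+x. \<integral>\<^sup>+y. f (c * x - s * y, s * x + c * y) \<partial>lborel \<partial>lborel)
      = (\<integral>\<^sup>+x. \<integral>\<^sup>+y. f (y, s * x) \<partial>lborel \<partial>lborel)"
  proof (rule nn_integral_cong)
    fix x
    show "(\<integral>\<^sup>+y. f (c * x - s * y, s * x + c * y) \<partial>lborel) = (\<integral>\<^sup>+y. f (y, s * x) \<partial>lborel)"
      using True s0 as nn_integral_real_affine[of "\<lambda>y. f (y, s * x)" "-s" 0] by simp
  qed
  also have "\<dots> = (\<integral>\<^sup>+x. \<integral>\<^sup>+y. f (y, x) \<partial>lborel \<partial>lborel)"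
    using s0 as nn_integral_real_affine[of "\<lambda>x. (\<integral>\<^sup>+y. f (y, x) \<partial>lborel)" s 0] by simp
  also have "\<dots> = (\<integral>\<^sup>+x. \<integral>\<^sup>+y. f (x, y) \<partial>lborel \<partial>lborel)"
    by (rule lborel_pair.Fubini') measurable
  finally show ?thesis .
next
  case False
  \<comment> \<open>The substitution \<open>x' = c x - s y\<close> at fixed \<open>y\<close> turns \<open>s x + c y\<close> into
    \<open>(s x' + y) / c\<close>, since \<open>c\<^sup>2 + s\<^sup>2 = 1\<close>.\<close>
  have "(\<integral>\<^sup>+x. \<integral>\<^sup>+y. f (c * x - s * y, s * x + c * y) \<partial>lborel \<partial>lborel) =
        (\<integral>\<^sup>+y. \<integral>\<^sup>+x. f (c * x - s * y, s * x + c * y) \<partial>lborel \<partial>lborel)"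
    by (rule lborel_pair.Fubini'[symmetric]) measurable
  also have "\<dots> = (\<integral>\<^sup>+y. \<integral>\<^sup>+x. \<bar>1/c\<bar> * f (x, (s * x + y) / c) \<partial>lborel \<partial>lborel)"
  proof (rule nn_integral_cong)
    fix y
    have *: "s * (s * y / c + (1/c) * x) + c * y = (s * x + y) / c" for x
    proof -
      have "s * (s * y / c + (1/c) * x) + c * y = (s * x + (c\<^sup>2 + s\<^sup>2) * y) / c"
        using False by (simp add: field_simps power2_eq_square)
      then show ?thesis using cs by simp
    qed
    have "(\<integral>\<^sup>+x. f (c * x - s * y, s * x + c * y) \<partial>lborel) = 
       \<bar>1/c\<bar> * (\<integral>\<^sup>+x. f (c * (s * y / c + (1/c) * x) - s * y, s * (s * y / c + (1/c) * x) + c * y) \<partial>lborel)"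
      using False by (subst nn_integral_real_affine[where c="1/c" and t="s * y / c"]) auto
    also have "\<dots> = (\<integral>\<^sup>+x. \<bar>1/c\<bar> * f (x, (s * x + y) / c) \<partial>lborel)"
      unfolding * using False by (simp add: nn_integral_cmult ring_distribs)
    finally show "(\<integral>\<^sup>+x. f (c * x - s * y, s * x + c * y) \<partial>lborel) = \<dots>" .
  qed
  also have "\<dots> = (\<integral>\<^sup>+x. \<integral>\<^sup>+y. \<bar>1/c\<bar> * f (x, (s * x + y) / c) \<partial>lborel \<partial>lborel)"
    by (rule lborel_pair.Fubini') measurable
  also have "\<dots> = (\<integral>\<^sup>+x. \<integral>\<^sup>+y. f (x, y) \<partial>lborel \<partial>lborel)"
  proof (rule nn_integral_cong)
    fix x
    have "(\<integral>\<^sup>+y. f (x, y) \<partial>lborel) = \<bar>1/c\<bar> * (\<integral>\<^sup>+y. f (x, s * x / c + (1/c) * y) \<partial>lborel)"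
      using False by (subst nn_integral_real_affine[where c="1/c" and t="s * x / c"]) auto
    also have "\<dots> = (\<integral>\<^sup>+y. \<bar>1/c\<bar> * f (x, (s * x + y) / c) \<partial>lborel)"
      by (simp add: nn_integral_cmult add_divide_distrib)
    finally show "(\<integral>\<^sup>+y. \<bar>1/c\<bar> * f (x, (s * x + y) / c) \<partial>lborel) = (\<integral>\<^sup>+y. f (x, y) \<partial>lborel)" ..
  qed
  finally show ?thesis .
qed

lemma nn_integral_gauss_pair:
  fixes f :: "real \<times> real \<Rightarrow> ennreal"
  assumes [measurable]: "f \<in> borel_measurable (borel \<Otimes>\<^sub>M borel)"
  shows "(\<integral>\<^sup>+x. \<integral>\<^sup>+y. f (x, y) \<partial>gauss \<sigma> \<partial>gauss \<sigma>) =
    (\<integral>\<^sup>+x. \<integral>\<^sup>+y. ennreal (normal_density 0 \<sigma> x * normal_density 0 \<sigma> y) * f (x, y) \<partial>lborel \<partial>lborel)"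
  by (simp add: nn_integral_density ennreal_mult' mult.assoc nn_integral_cmult)

text \<open>The product of the two densities depends on \<open>x\<^sup>2 + y\<^sup>2\<close> only.\<close>

lemma nn_integral_gauss_rotation:
  fixes f :: "real \<times> real \<Rightarrow> ennreal"
  assumes [measurable]: "f \<in> borel_measurable (borel \<Otimes>\<^sub>M borel)" and cs: "c\<^sup>2 + s\<^sup>2 = 1"
  shows "(\<integral>\<^sup>+x. \<integral>\<^sup>+y. f (c * x - s * y, s * x + c * y) \<partial>gauss \<sigma> \<partial>gauss \<sigma>) =
    (\<integral>\<^sup>+x. \<integral>\<^sup>+y. f (x, y) \<partial>gauss \<sigma> \<partial>gauss \<sigma>)"
proof -
  let ?d = "\<lambda>x y. normal_density 0 \<sigma> x * normal_density 0 \<sigma> y"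
  have d: "?d x y = ?d (c * x - s * y) (s * x + c * y)" for x y
  proof -
    have "(c * x - s * y)\<^sup>2 + (s * x + c * y)\<^sup>2 = (c\<^sup>2 + s\<^sup>2) * (x\<^sup>2 + y\<^sup>2)"
      by (simp add: power2_eq_square algebra_simps)
    then have "- x\<^sup>2 / (2 * \<sigma>\<^sup>2) + - y\<^sup>2 / (2 * \<sigma>\<^sup>2) =
        - (c * x - s * y)\<^sup>2 / (2 * \<sigma>\<^sup>2) + - (s * x + c * y)\<^sup>2 / (2 * \<sigma>\<^sup>2)"
      by (simp only: cs add_divide_distrib[symmetric]) simp
    then show ?thesis
      by (simp add: normal_density_def exp_add[symmetric])
  qed
  have "(\<integral>\<^sup>+x. \<integral>\<^sup>+y. f (c * x - s * y, s * x + c * y) \<partial>gauss \<sigma> \<partial>gauss \<sigma>) =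
    (\<integral>\<^sup>+x. \<integral>\<^sup>+y. ennreal (?d x y) * f (c * x - s * y, s * x + c * y) \<partial>lborel \<partial>lborel)"
    using nn_integral_gauss_pair[of "\<lambda>(x, y). f (c * x - s * y, s * x + c * y)" \<sigma>] by simp
  also have "\<dots> = (\<integral>\<^sup>+x. \<integral>\<^sup>+y. ennreal (?d (c * x - s * y) (s * x + c * y)) *
      f (c * x - s * y, s * x + c * y) \<partial>lborel \<partial>lborel)"
    by (simp only: d[symmetric])
  also have "\<dots> = (\<integral>\<^sup>+x. \<integral>\<^sup>+y. ennreal (?d x y) * f (x, y) \<partial>lborel \<partial>lborel)"
    using nn_integral_lborel_rotation[of "\<lambda>(x, y). ennreal (?d x y) * f (x, y)", OF _ cs] by simp
  also have "\<dots> = (\<integral>\<^sup>+x. \<integral>\<^sup>+y. f (x, y) \<partial>gauss \<sigma> \<partial>gauss \<sigma>)"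
    by (rule nn_integral_gauss_pair[symmetric]) measurable
  finally show ?thesis .
qed

section \<open>Joint law of two linear forms in independent Gaussian variables\<close>

lemma prob_space_gauss: "\<sigma> > 0 \<Longrightarrow> prob_space (gauss \<sigma>)"
  by (rule prob_space_normal_density)


text \<open>Induction step for the joint law of two linear forms: the pair \<open>(a x, b x + c y)\<close> receives the
  contribution \<open>(p t, q t)\<close> of a further normal variable. A rotation of \<open>(x, t)\<close> brings the
  first form back to a multiple of one variable, and a rotation of \<open>(y, t)\<close> then merges what is
  left of \<open>y\<close> and \<open>t\<close> in the second form. This is the reduction of a \<open>2 \<times> 3\<close> matrix to
  triangular shape by Givens rotations, and it preserves the Gram matrix of the rows. The signs
  \<open>a' \<ge> 0\<close> and \<open>c' \<le> 0\<close> are a normalization.\<close>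

lemma nn_integral_gauss_add_rank_one:
  assumes \<sigma>: "\<sigma> > 0"
  obtains a' b' c' where "a' \<ge> 0" "c' \<le> 0" "a'\<^sup>2 = a\<^sup>2 + p\<^sup>2" "a' * b' = a * b + p * q"
    "b'\<^sup>2 + c'\<^sup>2 = b\<^sup>2 + c\<^sup>2 + q\<^sup>2"
    "\<And>f. f \<in> borel_measurable (borel \<Otimes>\<^sub>M borel) \<Longrightarrow>
      (\<integral>\<^sup>+t. \<integral>\<^sup>+x. \<integral>\<^sup>+y. f (a * x + p * t, b * x + c * y + q * t) \<partial>gauss \<sigma> \<partial>gauss \<sigma> \<partial>gauss \<sigma>) =
      (\<integral>\<^sup>+x. \<integral>\<^sup>+y. f (a' * x, b' * x + c' * y) \<partial>gauss \<sigma> \<partial>gauss \<sigma>)"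
proof -
  interpret prob_space "gauss \<sigma>" using \<sigma> by (rule prob_space_gauss)
  interpret P: pair_sigma_finite "gauss \<sigma>" "gauss \<sigma>" ..
  define a' where "a' = sqrt (a\<^sup>2 + p\<^sup>2)"
  have a': "a'\<^sup>2 = a\<^sup>2 + p\<^sup>2" by (simp add: a'_def)
  obtain u v where uv: "u\<^sup>2 + v\<^sup>2 = 1" "a = a' * u" "p = a' * v"
    using rotation_exists[OF a'] by blast
  define b' where "b' = b * u + q * v"
  define q' where "q' = q * u - b * v"
  define c' where "c' = - sqrt (q'\<^sup>2 + c\<^sup>2)"
  have c': "c'\<^sup>2 = c\<^sup>2 + q'\<^sup>2" by (simp add: c'_def)
  obtain w z where wz: "w\<^sup>2 + z\<^sup>2 = 1" "c = c' * w" "q' = c' * z"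
    using rotation_exists[OF c'] by blast
  show ?thesis
  proof
    show "a' \<ge> 0" "c' \<le> 0" "a'\<^sup>2 = a\<^sup>2 + p\<^sup>2" by (auto simp: a'_def c'_def)
    show "a' * b' = a * b + p * q" unfolding b'_def uv(2,3) by (simp add: algebra_simps)
    have "b'\<^sup>2 + q'\<^sup>2 = (u\<^sup>2 + v\<^sup>2) * (b\<^sup>2 + q\<^sup>2)"
      unfolding b'_def q'_def by (simp add: power2_eq_square algebra_simps)
    then show "b'\<^sup>2 + c'\<^sup>2 = b\<^sup>2 + c\<^sup>2 + q\<^sup>2" using uv c' by simp
  next
    fix f :: "real \<times> real \<Rightarrow> ennreal"
    assume [measurable]: "f \<in> borel_measurable (borel \<Otimes>\<^sub>M borel)"
    let ?g = "\<lambda>(x, t). \<integral>\<^sup>+y. f (a * x + p * t, b * x + c * y + q * t) \<partial>gauss \<sigma>"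
    have rot1: "a * (u * x - v * t) + p * (v * x + u * t) = a' * x" for x t
    proof -
      have "a * (u * x - v * t) + p * (v * x + u * t) = a' * x * (u\<^sup>2 + v\<^sup>2)"
        unfolding uv(2,3) by (simp add: algebra_simps power2_eq_square)
      then show ?thesis using uv by simp
    qed
    have rot2: "b * (u * x - v * t) + c * y + q * (v * x + u * t) = b' * x + (c * y + q' * t)" for x y t
      unfolding b'_def q'_def by (simp add: algebra_simps)
    have rot3: "c * (w * y - z * t) + q' * (z * y + w * t) = c' * y" for y t
    proof -
      have "c * (w * y - z * t) + q' * (z * y + w * t) = c' * y * (w\<^sup>2 + z\<^sup>2)"
        unfolding wz(2,3) by (simp add: algebra_simps power2_eq_square)
      then show ?thesis using wz by simp
    qed
    have "(\<integral>\<^sup>+t. \<integral>\<^sup>+x. ?g (x, t) \<partial>gauss \<sigma> \<partial>gauss \<sigma>) = (\<integral>\<^sup>+x. \<integral>\<^sup>+t. ?g (x, t) \<partial>gauss \<sigma> \<partial>gauss \<sigma>)"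
      by (rule P.Fubini') simp
    also have "\<dots> = (\<integral>\<^sup>+x. \<integral>\<^sup>+t. ?g (u * x - v * t, v * x + u * t) \<partial>gauss \<sigma> \<partial>gauss \<sigma>)"
      by (rule nn_integral_gauss_rotation[OF _ uv(1), symmetric]) simp
    also have "\<dots> = (\<integral>\<^sup>+x. \<integral>\<^sup>+t. \<integral>\<^sup>+y. f (a' * x, b' * x + (c * y + q' * t)) \<partial>gauss \<sigma> \<partial>gauss \<sigma> \<partial>gauss \<sigma>)"
      by (simp only: prod.case rot1 rot2)
    also have "\<dots> = (\<integral>\<^sup>+x. \<integral>\<^sup>+y. f (a' * x, b' * x + c' * y) \<partial>gauss \<sigma> \<partial>gauss \<sigma>)"
    proof (rule nn_integral_cong)
      fix x
      let ?h = "\<lambda>(y, t). f (a' * x, b' * x + (c * y + q' * t))"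
      have "(\<integral>\<^sup>+t. \<integral>\<^sup>+y. ?h (y, t) \<partial>gauss \<sigma> \<partial>gauss \<sigma>) = (\<integral>\<^sup>+y. \<integral>\<^sup>+t. ?h (y, t) \<partial>gauss \<sigma> \<partial>gauss \<sigma>)"
        by (rule P.Fubini') simp
      also have "\<dots> = (\<integral>\<^sup>+y. \<integral>\<^sup>+t. ?h (w * y - z * t, z * y + w * t) \<partial>gauss \<sigma> \<partial>gauss \<sigma>)"
        by (rule nn_integral_gauss_rotation[OF _ wz(1), symmetric]) simp
      also have "\<dots> = (\<integral>\<^sup>+y. f (a' * x, b' * x + c' * y) \<partial>gauss \<sigma>)"
        using emeasure_space_1 by (simp add: rot3)
      finally show "(\<integral>\<^sup>+t. \<integral>\<^sup>+y. f (a' * x, b' * x + (c * y + q' * t)) \<partial>gauss \<sigma> \<partial>gauss \<sigma>) =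
          (\<integral>\<^sup>+y. f (a' * x, b' * x + c' * y) \<partial>gauss \<sigma>)" by simp
    qed
    finally show "(\<integral>\<^sup>+t. \<integral>\<^sup>+x. \<integral>\<^sup>+y. f (a * x + p * t, b * x + c * y + q * t) \<partial>gauss \<sigma> \<partial>gauss \<sigma> \<partial>gauss \<sigma>) =
      (\<integral>\<^sup>+x. \<integral>\<^sup>+y. f (a' * x, b' * x + c' * y) \<partial>gauss \<sigma> \<partial>gauss \<sigma>)"
      by simp
  qed
qed

text \<open>Two linear forms in independent normal variables have a joint law that depends only on their
  Gram matrix. Here the law is written as that of \<open>(a x, b x + c y)\<close>, the Cholesky form of
  this matrix.\<close>

lemma nn_integral_PiM_gauss_two_forms:
  fixes u v :: "'i \<Rightarrow> real"
  assumes \<sigma>: "\<sigma> > 0" and "finite I"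
  obtains a b c where "a \<ge> 0" "c \<le> 0" "a\<^sup>2 = (\<Sum>i\<in>I. (u i)\<^sup>2)" "a * b = (\<Sum>i\<in>I. u i * v i)"
    "b\<^sup>2 + c\<^sup>2 = (\<Sum>i\<in>I. (v i)\<^sup>2)"
    "\<And>f. f \<in> borel_measurable (borel \<Otimes>\<^sub>M borel) \<Longrightarrow>
      (\<integral>\<^sup>+\<xi>. f (\<Sum>i\<in>I. u i * \<xi> i, \<Sum>i\<in>I. v i * \<xi> i) \<partial>PiM I (\<lambda>_. gauss \<sigma>)) =
      (\<integral>\<^sup>+x. \<integral>\<^sup>+y. f (a * x, b * x + c * y) \<partial>gauss \<sigma> \<partial>gauss \<sigma>)"
proof -
  interpret N: prob_space "gauss \<sigma>" using \<sigma> by (rule prob_space_gauss)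
  interpret product_sigma_finite "\<lambda>_::'i. gauss \<sigma>" ..
  have "\<exists>a b c. a \<ge> 0 \<and> c \<le> 0 \<and> a\<^sup>2 = (\<Sum>i\<in>I. (u i)\<^sup>2) \<and> a * b = (\<Sum>i\<in>I. u i * v i) \<and>
    b\<^sup>2 + c\<^sup>2 = (\<Sum>i\<in>I. (v i)\<^sup>2) \<and>
    (\<forall>f\<in>borel_measurable (borel \<Otimes>\<^sub>M borel).
      (\<integral>\<^sup>+\<xi>. f (\<Sum>i\<in>I. u i * \<xi> i, \<Sum>i\<in>I. v i * \<xi> i) \<partial>PiM I (\<lambda>_. gauss \<sigma>)) =
      (\<integral>\<^sup>+x. \<integral>\<^sup>+y. f (a * x, b * x + c * y) \<partial>gauss \<sigma> \<partial>gauss \<sigma>))"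
    using \<open>finite I\<close>
  proof (induction I rule: finite_induct)
    case empty
    have "(\<integral>\<^sup>+\<xi>. f (0, 0) \<partial>PiM {} (\<lambda>_::'i. gauss \<sigma>)) = f (0, 0)" for f :: "real \<times> real \<Rightarrow> ennreal"
      by (simp add: PiM_empty nn_integral_count_space_finite)
    moreover have "(\<integral>\<^sup>+x. \<integral>\<^sup>+y. f (0, 0) \<partial>gauss \<sigma> \<partial>gauss \<sigma>) = f (0, 0)" for f :: "real \<times> real \<Rightarrow> ennreal"
      using N.emeasure_space_1 by simp
    ultimately show ?case
      by (intro exI[of _ 0]) simp
  next
    case (insert j I)
    then obtain a b c where abc: "a \<ge> 0" "c \<le> 0" "a\<^sup>2 = (\<Sum>i\<in>I. (u i)\<^sup>2)" "a * b = (\<Sum>i\<in>I. u i * v i)"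
      "b\<^sup>2 + c\<^sup>2 = (\<Sum>i\<in>I. (v i)\<^sup>2)"
      and IH: "\<And>f. f \<in> borel_measurable (borel \<Otimes>\<^sub>M borel) \<Longrightarrow>
      (\<integral>\<^sup>+\<xi>. f (\<Sum>i\<in>I. u i * \<xi> i, \<Sum>i\<in>I. v i * \<xi> i) \<partial>PiM I (\<lambda>_. gauss \<sigma>)) =
      (\<integral>\<^sup>+x. \<integral>\<^sup>+y. f (a * x, b * x + c * y) \<partial>gauss \<sigma> \<partial>gauss \<sigma>)"
      by blast
    obtain a' b' c' where abc': "a' \<ge> 0" "c' \<le> 0" "a'\<^sup>2 = a\<^sup>2 + (u j)\<^sup>2" "a' * b' = a * b + u j * v j"
      "b'\<^sup>2 + c'\<^sup>2 = b\<^sup>2 + c\<^sup>2 + (v j)\<^sup>2"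
      and step: "\<And>f. f \<in> borel_measurable (borel \<Otimes>\<^sub>M borel) \<Longrightarrow>
      (\<integral>\<^sup>+t. \<integral>\<^sup>+x. \<integral>\<^sup>+y. f (a * x + u j * t, b * x + c * y + v j * t) \<partial>gauss \<sigma> \<partial>gauss \<sigma> \<partial>gauss \<sigma>) =
      (\<integral>\<^sup>+x. \<integral>\<^sup>+y. f (a' * x, b' * x + c' * y) \<partial>gauss \<sigma> \<partial>gauss \<sigma>)"
      by (rule nn_integral_gauss_add_rank_one[OF \<sigma>, where a=a and b=b and c=c and p="u j" and q="v j"]) (rule that)
    show ?case
    proof (rule exI[of _ a'], rule exI[of _ b'], rule exI[of _ c'], intro conjI ballI)
      fix f :: "real \<times> real \<Rightarrow> ennreal"
      assume [measurable]: "f \<in> borel_measurable (borel \<Otimes>\<^sub>M borel)"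
      let ?S = "\<lambda>J w \<xi>. \<Sum>i\<in>J. w i * \<xi> i"
      have S: "?S (insert j I) w (\<xi>(j := t)) = ?S I w \<xi> + w j * t" for w \<xi> t
      proof -
        have "?S I w (\<xi>(j := t)) = ?S I w \<xi>"
          using insert.hyps by (intro sum.cong) auto
        then show ?thesis using insert.hyps by (simp add: add.commute)
      qed
      have "(\<integral>\<^sup>+\<xi>. f (?S (insert j I) u \<xi>, ?S (insert j I) v \<xi>) \<partial>PiM (insert j I) (\<lambda>_. gauss \<sigma>)) =
        (\<integral>\<^sup>+t. \<integral>\<^sup>+\<xi>. f (?S I u \<xi> + u j * t, ?S I v \<xi> + v j * t) \<partial>PiM I (\<lambda>_. gauss \<sigma>) \<partial>gauss \<sigma>)"
        using insert.hyps by (subst product_nn_integral_insert_rev) (auto simp only: S, measurable)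
      also have "\<dots> = (\<integral>\<^sup>+t. \<integral>\<^sup>+x. \<integral>\<^sup>+y. f (a * x + u j * t, b * x + c * y + v j * t) \<partial>gauss \<sigma> \<partial>gauss \<sigma> \<partial>gauss \<sigma>)"
      proof (rule nn_integral_cong)
        fix t
        show "(\<integral>\<^sup>+\<xi>. f (?S I u \<xi> + u j * t, ?S I v \<xi> + v j * t) \<partial>PiM I (\<lambda>_. gauss \<sigma>)) =
          (\<integral>\<^sup>+x. \<integral>\<^sup>+y. f (a * x + u j * t, b * x + c * y + v j * t) \<partial>gauss \<sigma> \<partial>gauss \<sigma>)"
          using IH[of "\<lambda>(x, y). f (x + u j * t, y + v j * t)"] by simp
      qed
      also have "\<dots> = (\<integral>\<^sup>+x. \<integral>\<^sup>+y. f (a' * x, b' * x + c' * y) \<partial>gauss \<sigma> \<partial>gauss \<sigma>)"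
        by (rule step) measurable
      finally show "(\<integral>\<^sup>+\<xi>. f (?S (insert j I) u \<xi>, ?S (insert j I) v \<xi>) \<partial>PiM (insert j I) (\<lambda>_. gauss \<sigma>)) = \<dots>" .
    qed (use insert.hyps abc abc' in auto)
  qed
  then show ?thesis using that by blast
qed

lemma nn_integral_abs_gauss:
  assumes "s > 0"
  shows "(\<integral>\<^sup>+x. ennreal (\<bar>x\<bar> * normal_density 0 s x) \<partial>lborel) = ennreal (s * sqrt (2 / pi))"
proof -
  have "has_bochner_integral lborel (\<lambda>x. \<bar>x\<bar> * normal_density 0 s x) (s * sqrt (2 / pi))"
    using normal_moment_abs_odd[where \<mu>=0 and \<sigma>=s and k=0] assms by (simp add: mult.commute)
  then show ?thesis
    by (subst nn_integral_eq_integral) (auto simp: has_bochner_integral_iff)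
qed

text \<open>The event says that \<open>y / x > b / d\<close>, and the quotient of two independent centred normal
  variables has the Cauchy distribution. The substitution \<open>y = x t\<close> produces its density
  \<open>1 / (pi (1 + t\<^sup>2))\<close>.\<close>

lemma emeasure_gauss_sector:
  assumes \<sigma>: "\<sigma> > 0" and d: "d > 0"
  shows "(\<integral>\<^sup>+x. \<integral>\<^sup>+y. indicator {(x, y). x * (b * x - d * y) < 0} (x, y) \<partial>gauss \<sigma> \<partial>gauss \<sigma>) =
    ennreal ((pi / 2 - arctan (b / d)) / pi)"
proof -
  define \<tau> where "\<tau> = b / d"
  let ?\<phi> = "normal_density 0 \<sigma>"
  have neg_iff: "x * (b * x - d * (x * t)) < 0 \<longleftrightarrow> t \<in> {\<tau><..}" if "x \<noteq> 0" for x t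
  proof -
    have "x * (b * x - d * (x * t)) = x\<^sup>2 * d * (\<tau> - t)"
      using d by (simp add: \<tau>_def power2_eq_square algebra_simps)
    moreover have "x\<^sup>2 * d > 0" using that d by simp
    ultimately have "x * (b * x - d * (x * t)) < 0 \<longleftrightarrow> \<tau> - t < 0"
      by (metis mult_less_0_iff order_less_asym)
    then show ?thesis by simp
  qed
  have "(\<integral>\<^sup>+x. \<integral>\<^sup>+y. indicator {(x, y). x * (b * x - d * y) < 0} (x, y) \<partial>gauss \<sigma> \<partial>gauss \<sigma>) =
     (\<integral>\<^sup>+x. \<integral>\<^sup>+y. ennreal (?\<phi> x * ?\<phi> y) * indicator {(x, y). x * (b * x - d * y) < 0} (x, y) \<partial>lborel \<partial>lborel)"
    by (rule nn_integral_gauss_pair) measurable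
  also have "\<dots> = (\<integral>\<^sup>+x. \<integral>\<^sup>+t. ennreal (\<bar>x\<bar> * (?\<phi> x * ?\<phi> (x * t))) * indicator {\<tau><..} t \<partial>lborel \<partial>lborel)"
  proof (rule nn_integral_cong)
    fix x
    show "(\<integral>\<^sup>+y. ennreal (?\<phi> x * ?\<phi> y) * indicator {(x, y). x * (b * x - d * y) < 0} (x, y) \<partial>lborel) =
      (\<integral>\<^sup>+t. ennreal (\<bar>x\<bar> * (?\<phi> x * ?\<phi> (x * t))) * indicator {\<tau><..} t \<partial>lborel)"
    proof (cases "x = 0")
      case False
      have "(\<integral>\<^sup>+y. ennreal (?\<phi> x * ?\<phi> y) * indicator {(x, y). x * (b * x - d * y) < 0} (x, y) \<partial>lborel) =
        ennreal \<bar>x\<bar> * (\<integral>\<^sup>+t. ennreal (?\<phi> x * ?\<phi> (x * t)) * indicator {(x, y). x * (b * x - d * y) < 0} (x, x * t) \<partial>lborel)"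
        using nn_integral_real_affine[of "\<lambda>y. ennreal (?\<phi> x * ?\<phi> y) * indicator {(x, y). x * (b * x - d * y) < 0} (x, y)" x 0] False
        by simp
      also have "\<dots> = ennreal \<bar>x\<bar> * (\<integral>\<^sup>+t. ennreal (?\<phi> x * ?\<phi> (x * t)) * indicator {\<tau><..} t \<partial>lborel)"
        using neg_iff[OF False] by (simp add: indicator_def)
      also have "\<dots> = (\<integral>\<^sup>+t. ennreal (\<bar>x\<bar> * (?\<phi> x * ?\<phi> (x * t))) * indicator {\<tau><..} t \<partial>lborel)"
        by (simp add: nn_integral_cmult[symmetric] ennreal_mult' mult.assoc)
      finally show ?thesis .
    qed simp
  qed
  also have "\<dots> = (\<integral>\<^sup>+t. \<integral>\<^sup>+x. ennreal (\<bar>x\<bar> * (?\<phi> x * ?\<phi> (x * t))) * indicator {\<tau><..} t \<partial>lborel \<partial>lborel)"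
    by (rule lborel_pair.Fubini') measurable
  also have "\<dots> = (\<integral>\<^sup>+t. ennreal (1 / (pi * (1 + t\<^sup>2))) * indicator {\<tau><..} t \<partial>lborel)"
  proof (rule nn_integral_cong)
    fix t :: real
    define s where "s = \<sigma> / sqrt (1 + t\<^sup>2)"
    have t: "1 + t\<^sup>2 > 0" by (simp add: add_pos_nonneg)
    have s: "s > 0" and s2: "s\<^sup>2 = \<sigma>\<^sup>2 / (1 + t\<^sup>2)"
      using \<sigma> t by (auto simp: s_def power_divide)
    \<comment> \<open>In \<open>x\<close> the product of the densities is again Gaussian, with variance \<open>s\<^sup>2\<close>, so that
      the inner integral is a first absolute moment.\<close>
    have dens: "?\<phi> x * ?\<phi> (x * t) = sqrt (2 * pi * s\<^sup>2) / (2 * pi * \<sigma>\<^sup>2) * normal_density 0 s x" for x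
    proof -
      have "- x\<^sup>2 / (2 * \<sigma>\<^sup>2) + - (x * t)\<^sup>2 / (2 * \<sigma>\<^sup>2) = - x\<^sup>2 / (2 * s\<^sup>2)"
        using \<sigma> t unfolding s2 by (simp add: field_simps power2_eq_square)
      moreover have "sqrt (2 * pi * \<sigma>\<^sup>2) * sqrt (2 * pi * \<sigma>\<^sup>2) = 2 * pi * \<sigma>\<^sup>2" by simp
      ultimately show ?thesis using \<sigma> s
        by (simp add: normal_density_def exp_add[symmetric])
    qed
    have "(\<integral>\<^sup>+x. ennreal (\<bar>x\<bar> * (?\<phi> x * ?\<phi> (x * t))) \<partial>lborel) =
       (\<integral>\<^sup>+x. ennreal (sqrt (2 * pi * s\<^sup>2) / (2 * pi * \<sigma>\<^sup>2)) * ennreal (\<bar>x\<bar> * normal_density 0 s x) \<partial>lborel)"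
      unfolding dens by (intro nn_integral_cong) (simp add: ennreal_mult'[symmetric] mult_ac)
    also have "\<dots> = ennreal (sqrt (2 * pi * s\<^sup>2) / (2 * pi * \<sigma>\<^sup>2) * (s * sqrt (2 / pi)))"
      using s by (subst nn_integral_cmult, measurable)
        (simp only: nn_integral_abs_gauss, subst ennreal_mult'[symmetric], auto)
    also have "sqrt (2 * pi * s\<^sup>2) / (2 * pi * \<sigma>\<^sup>2) * (s * sqrt (2 / pi)) = 
       (sqrt (2 * pi) * sqrt (2 / pi)) * s\<^sup>2 / (2 * pi * \<sigma>\<^sup>2)"
      using s by (simp add: real_sqrt_mult power2_eq_square)
    also have "sqrt (2 * pi) * sqrt (2 / pi) = 2"
      by (simp add: real_sqrt_mult[symmetric])
    also have "2 * s\<^sup>2 / (2 * pi * \<sigma>\<^sup>2) = 1 / (pi * (1 + t\<^sup>2))"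
    proof -
      have "2 * (k / w) / (2 * pi * k) = 1 / (pi * w)" if "k \<noteq> 0" for k w :: real
        using that by simp
      from this[of "\<sigma>\<^sup>2" "1 + t\<^sup>2"] show ?thesis unfolding s2 using \<sigma>
        by (metis less_irrefl power_not_zero)
    qed
    finally show "(\<integral>\<^sup>+x. ennreal (\<bar>x\<bar> * (?\<phi> x * ?\<phi> (x * t))) * indicator {\<tau><..} t \<partial>lborel) =
      ennreal (1 / (pi * (1 + t\<^sup>2))) * indicator {\<tau><..} t"
      by (simp add: nn_integral_multc)
  qed
  also have "\<dots> = (\<integral>\<^sup>+t. ennreal (1 / (pi * (1 + t\<^sup>2))) * indicator {\<tau>..} t \<partial>lborel)"
    by (intro nn_integral_cong_AE AE_I[where N="{\<tau>}"]) (auto simp: indicator_def)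
  also have "\<dots> = ennreal (1 / 2 - arctan \<tau> / pi)"
  proof (rule nn_integral_FTC_atLeast)
    show "((\<lambda>t. arctan t / pi) has_real_derivative 1 / (pi * (1 + t\<^sup>2))) (at t)" for t
      by (auto intro!: derivative_eq_intros simp: inverse_eq_divide mult.commute)
    show "((\<lambda>t. arctan t / pi) \<longlongrightarrow> 1 / 2) at_top"
      using tendsto_divide[OF tendsto_arctan_at_top tendsto_const[of pi]] by simp
    show "0 \<le> 1 / (pi * (1 + t\<^sup>2))" for t :: real
      by simp
  qed measurable
  also have "1 / 2 - arctan \<tau> / pi = (pi / 2 - arctan \<tau>) / pi" by (simp add: field_simps)
  finally show ?thesis by (simp add: \<tau>_def)
qed

section \<open>Zeros and sign changes of a function\<close>

text \<open>Distinct points of a finite set lie in distinct cells of a fine grid. Both the measurability of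
  the number of zeros and the count of sign changes use this.\<close>

lemma eventually_inj_on_floor:
  fixes Z :: "real set" and c :: real
  assumes "finite Z" and c: "c > 0"
  shows "\<forall>\<^sub>F k in sequentially. inj_on (\<lambda>z. \<lfloor>real k * z / c\<rfloor>) Z"
proof -
  have ev: "\<forall>\<^sub>F k in sequentially. \<lfloor>real k * z / c\<rfloor> = \<lfloor>real k * w / c\<rfloor> \<longrightarrow> z = w" for z w
  proof (cases "z = w")
    case False
    obtain k0 :: nat where k0: "c / \<bar>z - w\<bar> < real k0" using reals_Archimedean2 by blast
    have "\<lfloor>real k * z / c\<rfloor> \<noteq> \<lfloor>real k * w / c\<rfloor>" if "k \<ge> k0" for k
    proof
      assume "\<lfloor>real k * z / c\<rfloor> = \<lfloor>real k * w / c\<rfloor>"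
      then have "\<bar>real k * z / c - real k * w / c\<bar> < 1" by linarith
      moreover have "real k * z / c - real k * w / c = real k * (z - w) / c"
        by (simp add: diff_divide_distrib right_diff_distrib)
      ultimately have "real k * \<bar>z - w\<bar> / c < 1"
        using c by (simp add: abs_mult)
      then have "real k * \<bar>z - w\<bar> < c" using c by simp
      moreover have "c < real k * \<bar>z - w\<bar>"
        using k0 that False by (smt (verit) of_nat_mono pos_divide_less_eq zero_less_abs_iff mult_right_mono)
      ultimately show False by simp
    qed
    then show ?thesis unfolding eventually_sequentially by blast
  qed simp
  show ?thesis
    unfolding inj_on_def
    by (intro eventually_ball_finite ballI ev assms)
qed

text \<open>On a compact interval a continuous function has a zero iff its absolute value has infimum 0,
  and the infimum can be taken over a countable dense set. Clamping the rationals to the interval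
  yields such a set also when the interval is a single point.\<close>

lemma sets_zero_in_Icc:
  fixes F :: "'a \<Rightarrow> real \<Rightarrow> real"
  assumes meas [measurable]: "\<And>x. (\<lambda>\<omega>. F \<omega> x) \<in> borel_measurable M"
    and cont: "\<And>\<omega>. \<omega> \<in> space M \<Longrightarrow> continuous_on UNIV (F \<omega>)"
  shows "{\<omega> \<in> space M. \<exists>x\<in>{p..q}. F \<omega> x = 0} \<in> sets M"
proof (cases "p \<le> q")
  case True
  let ?c = "\<lambda>r. max p (min q r)"
  have "(\<exists>x\<in>{p..q}. F \<omega> x = 0) \<longleftrightarrow> (\<forall>n::nat. \<exists>r::rat. \<bar>F \<omega> (?c (of_rat r))\<bar> < 1 / real (Suc n))"
    (is "?L \<longleftrightarrow> ?R") if \<omega>: "\<omega> \<in> space M" for \<omega>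
  proof
    assume ?L
    then obtain x where x: "x \<in> {p..q}" "F \<omega> x = 0" by blast
    show ?R
    proof
      fix n :: nat
      have "continuous_on UNIV (\<lambda>y. \<bar>F \<omega> (?c y)\<bar>)"
        by (intro continuous_intros continuous_on_compose2[OF cont[OF \<omega>]]) auto
      then have "open {y. \<bar>F \<omega> (?c y)\<bar> < 1 / real (Suc n)}"
        by (intro open_Collect_less) (auto intro!: continuous_intros)
      moreover have "x \<in> {y. \<bar>F \<omega> (?c y)\<bar> < 1 / real (Suc n)}" using x by (auto simp: max_def min_def)
      ultimately obtain e where e: "e > 0" "ball x e \<subseteq> {y. \<bar>F \<omega> (?c y)\<bar> < 1 / real (Suc n)}"
        using open_contains_ball by blast
      obtain r :: rat where "x - e < of_rat r" "of_rat r < x + e"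
        using of_rat_dense[of "x - e" "x + e"] e by auto
      then have "of_rat r \<in> ball x e" by (auto simp: dist_real_def)
      then show "\<exists>r::rat. \<bar>F \<omega> (?c (of_rat r))\<bar> < 1 / real (Suc n)" using e(2) by blast
    qed
  next
    assume R: ?R
    have "continuous_on {p..q} (\<lambda>y. \<bar>F \<omega> y\<bar>)"
      by (intro continuous_intros continuous_on_subset[OF cont[OF \<omega>]]) auto
    then obtain x where x: "x \<in> {p..q}" "\<And>y. y \<in> {p..q} \<Longrightarrow> \<bar>F \<omega> x\<bar> \<le> \<bar>F \<omega> y\<bar>"
      using continuous_attains_inf[of "{p..q}" "\<lambda>y. \<bar>F \<omega> y\<bar>"] True by auto
    have "F \<omega> x = 0"
    proof (rule ccontr)
      assume "F \<omega> x \<noteq> 0"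
      then obtain n where "1 / real (Suc n) < \<bar>F \<omega> x\<bar>"
        using reals_Archimedean[of "\<bar>F \<omega> x\<bar>"] by (auto simp: inverse_eq_divide)
      moreover obtain r :: rat where "\<bar>F \<omega> (?c (of_rat r))\<bar> < 1 / real (Suc n)" using R by blast
      moreover have "?c (of_rat r) \<in> {p..q}" using True by auto
      ultimately show False using x(2) by fastforce
    qed
    then show ?L using x by blast
  qed
  then have "{\<omega> \<in> space M. \<exists>x\<in>{p..q}. F \<omega> x = 0} =
    {\<omega> \<in> space M. \<forall>n::nat. \<exists>r::rat. \<bar>F \<omega> (?c (of_rat r))\<bar> < 1 / real (Suc n)}" by blast
  also have "\<dots> \<in> sets M" by measurable
  finally show ?thesis .
qed simp

text \<open>The number of cells of the grid of mesh \<open>1 / k\<close> that contain a zero is a measurable function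
  by the previous lemma, as each cell is a countable union of compact intervals. Its
  supremum over \<open>k\<close> is the number of zeros, infinity included.
  Converting infinity to the real number 0 agrees with the cardinality of an infinite set, so the
  function is measurable everywhere and not only up to a null set.\<close>

lemma borel_measurable_card_zeros:
  fixes F :: "'a \<Rightarrow> real \<Rightarrow> real"
  assumes meas: "\<And>x. (\<lambda>\<omega>. F \<omega> x) \<in> borel_measurable M"
    and cont: "\<And>\<omega>. \<omega> \<in> space M \<Longrightarrow> continuous_on UNIV (F \<omega>)"
  shows "(\<lambda>\<omega>. real (card {x \<in> {p<..<q}. F \<omega> x = 0})) \<in> borel_measurable M"
proof -
  let ?Z = "\<lambda>\<omega>. {x \<in> {p<..<q}. F \<omega> x = 0}"
  let ?fl = "\<lambda>k x. \<lfloor>real k * x / 1\<rfloor>"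
  let ?I = "\<lambda>k. {\<lfloor>real k * p\<rfloor>..\<lfloor>real k * q\<rfloor>}"
  have cell: "{\<omega> \<in> space M. \<exists>x\<in>?Z \<omega>. ?fl k x = i} \<in> sets M" if "k > 0" for k i
  proof -
    let ?lo = "\<lambda>n. max (p + 1 / real (Suc n)) (i / k)"
    let ?hi = "\<lambda>n. min (q - 1 / real (Suc n)) ((i + 1) / k - 1 / real (Suc n))"
    have "(\<exists>x\<in>?Z \<omega>. ?fl k x = i) \<longleftrightarrow> (\<exists>n. \<exists>x\<in>{?lo n..?hi n}. F \<omega> x = 0)" for \<omega>
    proof
      assume "\<exists>x\<in>?Z \<omega>. ?fl k x = i"
      then obtain x where x: "p < x" "x < q" "F \<omega> x = 0" "i \<le> real k * x" "real k * x < i + 1"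
        by (auto simp: floor_eq_iff)
      then have "i / k \<le> x" "x < (i + 1) / k" using that by (auto simp: field_simps)
      then have "0 < min (min (x - p) (q - x)) ((i + 1) / k - x)" using x by auto
      then obtain n where "inverse (real (Suc n)) < min (min (x - p) (q - x)) ((i + 1) / k - x)"
        using reals_Archimedean by blast
      then have "x \<in> {?lo n..?hi n}" using \<open>i / k \<le> x\<close> by (auto simp: inverse_eq_divide)
      then show "\<exists>n. \<exists>x\<in>{?lo n..?hi n}. F \<omega> x = 0" using x by blast
    next
      assume "\<exists>n. \<exists>x\<in>{?lo n..?hi n}. F \<omega> x = 0"
      then obtain n x where nx: "x \<in> {?lo n..?hi n}" "F \<omega> x = 0" by blast
      define e where "e = 1 / real (Suc n)"
      have "e > 0" by (simp add: e_def)
      then have x: "p < x" "x < q" "i / k \<le> x" "x < (i + 1) / k"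
        using nx(1) unfolding e_def[symmetric] by auto
      then have "?fl k x = i" using that by (auto simp: floor_eq_iff field_simps)
      then show "\<exists>x\<in>?Z \<omega>. ?fl k x = i" using nx x by auto
    qed
    then have "{\<omega> \<in> space M. \<exists>x\<in>?Z \<omega>. ?fl k x = i} =
      (\<Union>n. {\<omega> \<in> space M. \<exists>x\<in>{?lo n..?hi n}. F \<omega> x = 0})" by blast
    also have "\<dots> \<in> sets M"
      using sets_zero_in_Icc[of F M, OF meas cont] by blast
    finally show ?thesis .
  qed
  have sub: "?fl k ` ?Z \<omega> \<subseteq> ?I k" for k \<omega>
    by (auto intro!: floor_mono mult_left_mono)
  have fin: "finite (?fl k ` ?Z \<omega>)" for k \<omega>
    by (rule finite_subset[OF sub]) simp
  have card_ind: "(\<Sum>i\<in>A. indicator B i) = (of_nat (card (A \<inter> B)) :: ennreal)" if "finite A" for A B :: "int set"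
    using that by (simp add: indicator_def of_bool_def sum.If_cases)
  define N where "N = (\<lambda>\<omega>. SUP k. (of_nat (card (?fl (Suc k) ` ?Z \<omega>)) :: ennreal))"
  have "N \<in> borel_measurable M"
    unfolding N_def
  proof (rule borel_measurable_SUP)
    fix k
    have eq: "(of_nat (card (?fl (Suc k) ` ?Z \<omega>)) :: ennreal) =
        (\<Sum>i\<in>?I (Suc k). indicator {\<omega> \<in> space M. \<exists>x\<in>?Z \<omega>. ?fl (Suc k) x = i} \<omega>)"
      if "\<omega> \<in> space M" for \<omega>
    proof -
      have "(\<Sum>i\<in>?I (Suc k). indicator {\<omega> \<in> space M. \<exists>x\<in>?Z \<omega>. ?fl (Suc k) x = i} \<omega>) =
        (\<Sum>i\<in>?I (Suc k). indicator (?fl (Suc k) ` ?Z \<omega>) i :: ennreal)"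
        using that by (intro sum.cong) (auto simp: indicator_def)
      also have "\<dots> = of_nat (card (?I (Suc k) \<inter> (?fl (Suc k) ` ?Z \<omega>)))"
        by (rule card_ind) simp
      also have "?I (Suc k) \<inter> (?fl (Suc k) ` ?Z \<omega>) = ?fl (Suc k) ` ?Z \<omega>" using sub by blast
      finally show ?thesis ..
    qed
    show "(\<lambda>\<omega>. of_nat (card (?fl (Suc k) ` ?Z \<omega>)) :: ennreal) \<in> borel_measurable M"
      by (subst measurable_cong[OF eq], assumption)
         (intro borel_measurable_sum borel_measurable_indicator cell, simp)
  qed simp
  then have "(\<lambda>\<omega>. enn2real (N \<omega>)) \<in> borel_measurable M" by measurable
  moreover have "enn2real (N \<omega>) = real (card (?Z \<omega>))" for \<omega>
  proof -
    have large: "of_nat (card W) \<le> N \<omega>" if W: "finite W" "W \<subseteq> ?Z \<omega>" for W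
    proof -
      have "\<forall>\<^sub>F k in sequentially. inj_on (?fl k) W"
        using eventually_inj_on_floor[OF W(1), of 1] by simp
      then obtain k where k: "inj_on (?fl (Suc k)) W"
        unfolding eventually_sequentially using le_SucI by blast
      have "card W = card (?fl (Suc k) ` W)" using k by (simp add: card_image)
      also have "\<dots> \<le> card (?fl (Suc k) ` ?Z \<omega>)" by (intro card_mono fin image_mono W)
      finally have "(of_nat (card W) :: ennreal) \<le> of_nat (card (?fl (Suc k) ` ?Z \<omega>))" by simp
      also have "\<dots> \<le> N \<omega>" unfolding N_def by (rule SUP_upper) simp
      finally show ?thesis .
    qed
    show ?thesis
    proof (cases "finite (?Z \<omega>)")
      case True
      have "N \<omega> \<le> of_nat (card (?Z \<omega>))"
        unfolding N_def using True by (intro SUP_least) (simp add: card_image_le)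
      with large[OF True] have "N \<omega> = of_nat (card (?Z \<omega>))" by (simp add: antisym)
      then show ?thesis by simp
    next
      case False
      have "of_nat m \<le> N \<omega>" for m
        using infinite_arbitrarily_large[OF False, of m] large by metis
      then have "(SUP m. of_nat m) \<le> N \<omega>" by (intro SUP_least)
      then have "N \<omega> = top" by (simp add: ennreal_SUP_of_nat_eq_top top_unique)
      then show ?thesis using False by simp
    qed
  qed
  ultimately show ?thesis by simp
qed

text \<open>An accumulation point of zeros in the compact interval would be a zero at which the difference
  quotients vanish along the zeros, hence a double zero.\<close>

lemma finite_zeros_if_simple:
  fixes f f' :: "real \<Rightarrow> real"
  assumes der: "\<And>x. (f has_real_derivative f' x) (at x)"
    and simple: "\<And>x. x \<in> {p..q} \<Longrightarrow> f x = 0 \<Longrightarrow> f' x \<noteq> 0"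
  shows "finite {x \<in> {p..q}. f x = 0}"
proof (rule ccontr)
  let ?Z = "{x \<in> {p..q}. f x = 0}"
  assume inf: "infinite ?Z"
  have "closed ({p..q} \<inter> f -` {0})"
    by (intro closed_Int closed_atLeastAtMost continuous_closed_vimage) (use der in \<open>auto intro: DERIV_isCont\<close>)
  moreover have "{p..q} \<inter> f -` {0} = ?Z" by auto
  ultimately have "closed ?Z" by simp
  moreover have "bounded ?Z" by (rule bounded_subset[OF bounded_closed_interval[of p q]]) auto
  ultimately have "compact ?Z" by (simp add: compact_eq_bounded_closed)
  then obtain z where z: "z \<in> ?Z" "z islimpt ?Z"
    using inf unfolding compact_eq_Bolzano_Weierstrass by blast
  have "((\<lambda>y. (f y - f z) / (y - z)) \<longlongrightarrow> f' z) (at z)"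
    using der[of z] by (simp add: has_field_derivative_iff)
  then have "\<forall>\<^sub>F y in at z. (f y - f z) / (y - z) \<noteq> 0"
    using z simple by (intro tendsto_imp_eventually_ne) auto
  then have "\<forall>\<^sub>F y in at z. y \<notin> ?Z"
    by (rule eventually_mono) (use z in auto)
  then show False using z(2) by (simp add: islimpt_iff_eventually)
qed

text \<open>If the endpoint values had the same sign, then so would all values on the interval except at
  \<open>z\<close>, by the intermediate value theorem. So \<open>z\<close> would be a local extremum and its derivative
  would vanish.\<close>

lemma simple_zero_sign_change:
  fixes f :: "real \<Rightarrow> real"
  assumes cont: "continuous_on {p..r} f" and der: "(f has_real_derivative l) (at z)" and "l \<noteq> 0"
    and z: "p < z" "z < r" "f z = 0"
    and unique: "\<And>x. x \<in> {p..r} \<Longrightarrow> f x = 0 \<Longrightarrow> x = z"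
  shows "f p * f r < 0"
proof (rule ccontr)
  assume "\<not> f p * f r < 0"
  moreover have ne: "f p \<noteq> 0" "f r \<noteq> 0" using unique[of p] unique[of r] z by auto
  ultimately have pr: "f r * f p > 0" by (simp add: not_less less_le mult.commute)
  \<comment> \<open>Multiplying by \<open>f p\<close> makes the endpoint values positive, which leaves one case.\<close>
  define g where "g = (\<lambda>x. f x * f p)"
  have contg: "continuous_on {s..t} g" if "p \<le> s" "t \<le> r" for s t
    unfolding g_def by (intro continuous_intros continuous_on_subset[OF cont]) (use that in auto)
  have gp: "g p > 0" and gr: "g r > 0" using ne pr by (auto simp: g_def zero_less_mult_iff linorder_neq_iff)
  have g0: "x = z" if "x \<in> {p..r}" "g x = 0" for x
    using that unique ne by (auto simp: g_def)
  have g_nonneg: "g x \<ge> 0" if x: "x \<in> {p..r}" for x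
  proof (rule ccontr)
    assume neg: "\<not> g x \<ge> 0"
    then have "x \<noteq> z" using z by (auto simp: g_def)
    then consider "x < z" | "z < x" by linarith
    then show False
    proof cases
      case 1
      obtain t where "p \<le> t" "t \<le> x" "g t = 0"
        using IVT2'[of g x 0 p] gp neg x contg[of p x] by auto
      then show False using g0[of t] 1 x by auto
    next
      case 2
      obtain t where "x \<le> t" "t \<le> r" "g t = 0"
        using IVT'[of g x 0 r] gr neg x contg[of x r] by auto
      then show False using g0[of t] 2 x by auto
    qed
  qed
  have "(g has_real_derivative l * f p) (at z)"
    unfolding g_def by (rule DERIV_cmult_right[OF der])
  then have "l * f p = 0"
  proof (rule DERIV_local_min)
    show "0 < min (z - p) (r - z)" using z by auto
    show "\<forall>y. \<bar>z - y\<bar> < min (z - p) (r - z) \<longrightarrow> g z \<le> g y"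
    proof (intro allI impI)
      fix y assume "\<bar>z - y\<bar> < min (z - p) (r - z)"
      then have "y \<in> {p..r}" by auto
      then show "g z \<le> g y" using g_nonneg[of y] z by (simp add: g_def)
    qed
  qed
  then show False using ne \<open>l \<noteq> 0\<close> by simp
qed

definition sign_changes :: "real \<Rightarrow> nat \<Rightarrow> (real \<Rightarrow> real) \<Rightarrow> nat" where
  "sign_changes q k f = card {i \<in> {..<k}. f (q * real i / real k) * f (q * real (Suc i) / real k) < 0}"

text \<open>The intermediate value theorem places a zero strictly inside each cell with a sign change.\<close>

lemma sign_changes_le_card_zeros:
  fixes f :: "real \<Rightarrow> real"
  assumes cont: "continuous_on UNIV f" and q: "q > 0"
    and fin: "finite {x \<in> {0<..<q}. f x = 0}"
  shows "sign_changes q k f \<le> card {x \<in> {0<..<q}. f x = 0}"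
proof -
  let ?S = "{i \<in> {..<k}. f (q * real i / real k) * f (q * real (Suc i) / real k) < 0}"
  have "\<forall>i\<in>?S. \<exists>x. q * real i / real k < x \<and> x < q * real (Suc i) / real k \<and> f x = 0"
  proof
    fix i assume i: "i \<in> ?S"
    let ?a = "q * real i / real k" and ?b = "q * real (Suc i) / real k"
    have ab: "?a \<le> ?b" using q by (intro divide_right_mono mult_left_mono) auto
    have c: "continuous_on {?a..?b} f" using cont continuous_on_subset by blast
    have neg: "f ?a * f ?b < 0" using i by simp
    then consider "f ?a < 0" "0 < f ?b" | "f ?b < 0" "0 < f ?a" by (auto simp: mult_less_0_iff)
    then obtain x where "?a \<le> x" "x \<le> ?b" "f x = 0"
      using IVT'[of f ?a 0 ?b, OF _ _ ab c] IVT2'[of f ?b 0 ?a, OF _ _ ab c] by (metis less_imp_le)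
    moreover have "x \<noteq> ?a" "x \<noteq> ?b" using neg \<open>f x = 0\<close> by auto
    ultimately show "\<exists>x. ?a < x \<and> x < ?b \<and> f x = 0" by (auto simp: less_le)
  qed
  from bchoice[OF this] obtain g where g: "\<And>i. i \<in> ?S \<Longrightarrow> q * real i / real k < g i \<and> g i < q * real (Suc i) / real k \<and> f (g i) = 0"
    by blast
  have "inj_on g ?S"
  proof (rule linorder_inj_onI')
    fix i j assume ij: "i \<in> ?S" "j \<in> ?S" "i < j"
    have "g i < q * real (Suc i) / real k" using g ij by blast
    also have "\<dots> \<le> q * real j / real k" using q ij by (intro divide_right_mono mult_left_mono) auto
    also have "\<dots> < g j" using g ij by blast
    finally show "g i \<noteq> g j" by simp
  qed
  moreover have "g ` ?S \<subseteq> {x \<in> {0<..<q}. f x = 0}"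
  proof safe
    fix i assume i: "i < k" "f (q * real i / real k) * f (q * real (Suc i) / real k) < 0"
    then have gi: "q * real i / real k < g i" "g i < q * real (Suc i) / real k" "f (g i) = 0" using g by auto
    have "0 \<le> q * real i / real k" using q by simp
    then have "0 < g i" using gi by linarith
    moreover have "q * real (Suc i) / real k \<le> q * real k / real k"
      using q i by (intro divide_right_mono mult_left_mono) auto
    then have "g i < q" using gi i by auto
    ultimately show "g i \<in> {0<..<q}" "f (g i) = 0" using gi by auto
  qed
  ultimately show ?thesis unfolding sign_changes_def using fin by (rule card_inj_on_le)
qed

text \<open>Once the cells separate the zeros, every zero is alone in its cell and, being simple, forces a sign
  change there. Grid points must not be zeros, as a zero on the grid is invisible to strict
  sign changes. For \<open>k = 0\<close> the assumption \<open>grid\<close> speaks of the point 0 because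
  \<open>x / 0 = 0\<close>, so it is an instance of the case \<open>i = 0\<close>.\<close>

lemma eventually_card_zeros_le_sign_changes:
  fixes f f' :: "real \<Rightarrow> real"
  assumes der: "\<And>x. (f has_real_derivative f' x) (at x)" and q: "q > 0"
    and simple: "\<And>x. x \<in> {0..q} \<Longrightarrow> f x = 0 \<Longrightarrow> f' x \<noteq> 0"
    and grid: "\<And>i k. f (q * real i / real k) \<noteq> 0"
  shows "\<forall>\<^sub>F k in sequentially. card {x \<in> {0<..<q}. f x = 0} \<le> sign_changes q k f"
proof -
  let ?Z = "{x \<in> {0<..<q}. f x = 0}"
  have "finite {x \<in> {0..q}. f x = 0}" by (rule finite_zeros_if_simple[OF der simple])
  then have fin: "finite ?Z" by (rule finite_subset[rotated]) auto
  have cont: "continuous_on A f" for A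
    using der by (meson DERIV_isCont continuous_at_imp_continuous_on)
  show ?thesis
    using eventually_inj_on_floor[OF fin q] eventually_gt_at_top[of "0::nat"]
  proof eventually_elim
    case (elim k)
    let ?S = "{i \<in> {..<k}. f (q * real i / real k) * f (q * real (Suc i) / real k) < 0}"
    let ?g = "\<lambda>z. nat \<lfloor>real k * z / q\<rfloor>"
    have cell: "\<lfloor>real k * x / q\<rfloor> = int i" if "q * real i / real k < x" "x < q * real (Suc i) / real k" for x i
      using that q elim(2) by (intro floor_unique) (auto simp: field_simps)
    have "inj_on ?g ?Z"
    proof (rule inj_onI)
      fix x y assume xy: "x \<in> ?Z" "y \<in> ?Z" "?g x = ?g y"
      have "0 \<le> \<lfloor>real k * x / q\<rfloor>" "0 \<le> \<lfloor>real k * y / q\<rfloor>" using xy q by auto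
      then have "\<lfloor>real k * x / q\<rfloor> = \<lfloor>real k * y / q\<rfloor>" using xy by (metis nat_eq_iff2)
      then show "x = y" using elim(1) xy by (auto dest: inj_onD)
    qed
    moreover have "?g ` ?Z \<subseteq> ?S"
    proof
      fix i assume "i \<in> ?g ` ?Z"
      then obtain z where z: "z \<in> ?Z" "i = ?g z" by blast
      have "0 \<le> real k * z / q" using z q by auto
      then have fl: "real i = of_int \<lfloor>real k * z / q\<rfloor>" using z by simp
      have "real i \<le> real k * z / q" "real k * z / q < real i + 1" unfolding fl by linarith+
      then have le: "q * real i / real k \<le> z" "z < q * real (Suc i) / real k"
        using q elim(2) by (auto simp: field_simps)
      have ik: "i < k"
      proof -
        have "real k * z / q < real k" using z q elim(2) by (simp add: field_simps)
        then show ?thesis using \<open>real i \<le> real k * z / q\<close> by linarith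
      qed
      have lt: "q * real i / real k < z" using le(1) grid[of i k] z by (auto simp: less_le)
      have "q * real (Suc i) / real k \<le> q * real k / real k"
        using q ik by (intro divide_right_mono mult_left_mono) auto
      then have top: "q * real (Suc i) / real k \<le> q" using elim(2) by simp
      have bot: "0 \<le> q * real i / real k" using q by simp
      have "f (q * real i / real k) * f (q * real (Suc i) / real k) < 0"
      proof (rule simple_zero_sign_change[OF cont der _ lt le(2)])
        show "f' z \<noteq> 0" "f z = 0" using z simple by auto
        fix x assume x: "x \<in> {q * real i / real k..q * real (Suc i) / real k}" "f x = 0"
        then have "q * real i / real k \<noteq> x" "x \<noteq> q * real (Suc i) / real k"
          using grid by blast+
        then have x': "q * real i / real k < x" "x < q * real (Suc i) / real k"
          using x(1) by (meson atLeastAtMost_iff le_neq_trans)+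
        then have "x \<in> ?Z" using x top bot by auto
        then show "x = z"
          using z cell[OF x'] cell[OF lt le(2)] by (intro inj_onD[OF elim(1)]) auto
      qed
      then show "i \<in> ?S" using ik by simp
    qed
    ultimately show ?case unfolding sign_changes_def by (intro card_inj_on_le[of ?g]) auto
  qed
qed

section \<open>Mean number of zeros of a Gaussian trigonometric sum\<close>

lemma double_zero_quadratic_bound:
  fixes f f' f'' :: "real \<Rightarrow> real"
  assumes f: "\<And>x. (f has_real_derivative f' x) (at x)"
    and f': "\<And>x. (f' has_real_derivative f'' x) (at x)"
    and K: "\<And>x. \<bar>f'' x\<bar> \<le> K"
    and z: "f z = 0" "f' z = 0"
  shows "\<bar>f y\<bar> \<le> K * (y - z)\<^sup>2"
proof -
  have "norm (f' t - f' z) \<le> K * norm (t - z)" for t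
    by (rule field_differentiable_bound[of UNIV]) (use f' K in auto)
  then have f'_le: "\<bar>f' t\<bar> \<le> K * \<bar>t - z\<bar>" for t using z by simp
  have K0: "K \<ge> 0" using K[of 0] by linarith
  have "norm (f y - f z) \<le> (K * \<bar>y - z\<bar>) * norm (y - z)"
  proof (rule field_differentiable_bound[of "closed_segment z y"])
    fix t assume "t \<in> closed_segment z y"
    then have "\<bar>t - z\<bar> \<le> \<bar>y - z\<bar>" by (auto simp: closed_segment_eq_real_ivl split: if_splits)
    then show "norm (f' t) \<le> K * \<bar>y - z\<bar>"
      using f'_le[of t] mult_left_mono[OF _ K0] by (smt (verit) real_norm_def)
  next
    show "(f has_field_derivative f' t) (at t within closed_segment z y)" for t
      using f by (rule DERIV_subset) simp
  qed auto
  then show ?thesis using z by (simp add: power2_eq_square mult.assoc)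
qed

lemma tendsto_second_difference_cos:
  fixes t :: real
  shows "(\<lambda>k. (real k)\<^sup>2 * (1 - cos (t / real k))) \<longlonglongrightarrow> t\<^sup>2 / 2"
proof -
  have "(\<lambda>k. (real k)\<^sup>2 * (1 - cos (t / real k))) \<longlonglongrightarrow> t * t / 2" by real_asymp
  then show ?thesis by (simp add: power2_eq_square)
qed

text \<open>The frequencies are arbitrary. Only the case that all of them vanish is excluded: there the process
  is a constant and the kernel below never drops below its value at 0.\<close>

locale gaussian_trig_sum = prob_space M for M :: "'w measure" +
  fixes \<sigma> :: real and J :: "'j set" and \<theta> :: "'j \<Rightarrow> real" and a b :: "'j \<Rightarrow> 'w \<Rightarrow> real"
  assumes \<sigma>: "\<sigma> > 0" and finite_J: "finite J" and \<theta>_nonzero: "\<exists>j\<in>J. \<theta> j \<noteq> 0"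
    and indep: "indep_vars (\<lambda>_. borel) (case_sum a b) (J <+> J)"
    and distributed_a: "\<And>j. j \<in> J \<Longrightarrow> distributed M lborel (a j) (normal_density 0 \<sigma>)"
    and distributed_b: "\<And>j. j \<in> J \<Longrightarrow> distributed M lborel (b j) (normal_density 0 \<sigma>)"
begin

definition process :: "'w \<Rightarrow> real \<Rightarrow> real" where
  "process \<omega> x = (\<Sum>j\<in>J. a j \<omega> * cos (\<theta> j * x) + b j \<omega> * sin (\<theta> j * x))"

definition process_deriv :: "'w \<Rightarrow> real \<Rightarrow> real" where
  "process_deriv \<omega> x = (\<Sum>j\<in>J. \<theta> j * (b j \<omega> * cos (\<theta> j * x) - a j \<omega> * sin (\<theta> j * x)))"

text \<open>Up to the factor \<open>\<sigma>\<^sup>2\<close> this is the covariance of \<open>process \<omega> x\<close> and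
  \<open>process \<omega> (x + h)\<close>, whatever \<open>x\<close> is.\<close>

definition kernel :: "real \<Rightarrow> real" where
  "kernel h = (\<Sum>j\<in>J. cos (\<theta> j * h))"

abbreviation L :: real where "L \<equiv> real (card J)"

lemma L_pos: "L > 0"
  using finite_J \<theta>_nonzero by (auto simp: card_gt_0_iff)

lemma measurable_coeffs [measurable]:
  "j \<in> J \<Longrightarrow> a j \<in> borel_measurable M" "j \<in> J \<Longrightarrow> b j \<in> borel_measurable M"
  using distributed_measurable[OF distributed_a] distributed_measurable[OF distributed_b] by simp_all

lemma measurable_process [measurable]: "(\<lambda>\<omega>. process \<omega> x) \<in> borel_measurable M"
  unfolding process_def by measurable

lemma DERIV_process: "(process \<omega> has_real_derivative process_deriv \<omega> x) (at x)"
  unfolding process_def[abs_def] process_deriv_def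
  by (auto intro!: derivative_eq_intros DERIV_sum sum.cong simp: algebra_simps)

lemma continuous_process: "continuous_on A (process \<omega>)"
  using DERIV_process by (meson DERIV_isCont continuous_at_imp_continuous_on)

text \<open>The sum on the right bounds the second derivative of the process.\<close>

lemma double_zero_bound:
  assumes "process \<omega> z = 0" "process_deriv \<omega> z = 0"
  shows "\<bar>process \<omega> y\<bar> \<le> (\<Sum>j\<in>J. (\<theta> j)\<^sup>2 * (\<bar>a j \<omega>\<bar> + \<bar>b j \<omega>\<bar>)) * (y - z)\<^sup>2"
proof (rule double_zero_quadratic_bound[OF DERIV_process _ _ assms])
  let ?Y'' = "\<lambda>x. - (\<Sum>j\<in>J. (\<theta> j)\<^sup>2 * (a j \<omega> * cos (\<theta> j * x) + b j \<omega> * sin (\<theta> j * x)))"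
  show "(process_deriv \<omega> has_real_derivative ?Y'' x) (at x)" for x
    unfolding process_deriv_def[abs_def] sum_negf[symmetric]
    by (auto intro!: derivative_eq_intros DERIV_sum sum.cong simp: algebra_simps power2_eq_square)
  have "\<bar>p * cos t + r * sin t\<bar> \<le> \<bar>p\<bar> + \<bar>r\<bar>" for p r t :: real
  proof -
    have "\<bar>p * cos t + r * sin t\<bar> \<le> \<bar>p\<bar> * \<bar>cos t\<bar> + \<bar>r\<bar> * \<bar>sin t\<bar>"
      by (metis abs_mult abs_triangle_ineq)
    also have "\<dots> \<le> \<bar>p\<bar> * 1 + \<bar>r\<bar> * 1" by (intro add_mono mult_left_mono) auto
    finally show ?thesis by simp
  qed
  then show "\<bar>?Y'' x\<bar> \<le> (\<Sum>j\<in>J. (\<theta> j)\<^sup>2 * (\<bar>a j \<omega>\<bar> + \<bar>b j \<omega>\<bar>))" for x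
    unfolding abs_minus_cancel
    by (intro order_trans[OF sum_abs] sum_mono) (simp add: abs_mult mult_left_mono)
qed

text \<open>The process at \<open>x\<close> and at \<open>y\<close> gives two linear forms in the coefficients. Their Gram matrix has
  the diagonal entries \<open>L\<close>, by \<open>cos\<^sup>2 + sin\<^sup>2 = 1\<close>, and the off-diagonal entry
  \<open>kernel (y - x)\<close>, by the addition theorem. Hence the law is stationary.\<close>

lemma nn_integral_process_pair:
  obtains A B C where "A > 0" "C \<le> 0" "A\<^sup>2 = L" "A * B = kernel (y - x)" "B\<^sup>2 + C\<^sup>2 = L"
    "\<And>f. f \<in> borel_measurable (borel \<Otimes>\<^sub>M borel) \<Longrightarrow> (\<integral>\<^sup>+\<omega>. f (process \<omega> x, process \<omega> y) \<partial>M) =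
      (\<integral>\<^sup>+s. \<integral>\<^sup>+t. f (A * s, B * s + C * t) \<partial>gauss \<sigma> \<partial>gauss \<sigma>)"
proof -
  let ?I = "J <+> J"
  let ?X = "case_sum a b"
  let ?u = "\<lambda>x. case_sum (\<lambda>j. cos (\<theta> j * x)) (\<lambda>j. sin (\<theta> j * x))"
  have fin: "finite ?I" using finite_J by simp
  have I: "?I \<noteq> {}" using \<theta>_nonzero by auto
  have [measurable]: "?X i \<in> borel_measurable M" if "i \<in> ?I" for i using that by auto
  have "distr M borel (?X i) = gauss \<sigma>" if "i \<in> ?I" for i
  proof -
    have "distributed M lborel (?X i) (normal_density 0 \<sigma>)"
      using that distributed_a distributed_b by auto
    then have "distr M lborel (?X i) = gauss \<sigma>" by (rule distributed_distr_eq_density)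
    moreover have "distr M lborel (?X i) = distr M borel (?X i)" by (rule distr_cong) auto
    ultimately show ?thesis by simp
  qed
  then have "PiM ?I (\<lambda>i. distr M borel (?X i)) = PiM ?I (\<lambda>_. gauss \<sigma>)"
    by (intro PiM_cong) auto
  then have joint: "distr M (PiM ?I (\<lambda>_. borel)) (\<lambda>\<omega>. \<lambda>i\<in>?I. ?X i \<omega>) = PiM ?I (\<lambda>_. gauss \<sigma>)"
    using indep by (subst (asm) indep_vars_iff_distr_eq_PiM'[OF I]) auto
  have Y_eq: "process \<omega> x = (\<Sum>i\<in>?I. ?u x i * ?X i \<omega>)" for \<omega> x
    using finite_J by (simp add: process_def sum.Plus sum.distrib mult.commute)
  have sq: "(\<Sum>i\<in>?I. (?u x i)\<^sup>2) = L" for x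
    using finite_J by (simp add: sum.Plus sum.distrib[symmetric])
  have cross: "(\<Sum>i\<in>?I. ?u x i * ?u y i) = kernel (y - x)"
    using finite_J by (simp add: sum.Plus sum.distrib[symmetric] kernel_def right_diff_distrib cos_diff mult.commute)
  have law: "(\<integral>\<^sup>+\<omega>. f (process \<omega> x, process \<omega> y) \<partial>M) =
      (\<integral>\<^sup>+\<xi>. f (\<Sum>i\<in>?I. ?u x i * \<xi> i, \<Sum>i\<in>?I. ?u y i * \<xi> i) \<partial>PiM ?I (\<lambda>_. gauss \<sigma>))"
    if [measurable]: "f \<in> borel_measurable (borel \<Otimes>\<^sub>M borel)" for f :: "real \<times> real \<Rightarrow> ennreal"
    unfolding joint[symmetric] Y_eq
    by (subst nn_integral_distr) (auto intro!: nn_integral_cong arg_cong[of _ _ f] sum.cong)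
  obtain A C B where *: "A \<ge> 0" "C \<le> 0" "A\<^sup>2 = (\<Sum>i\<in>?I. (?u x i)\<^sup>2)" "A * B = (\<Sum>i\<in>?I. ?u x i * ?u y i)"
    "B\<^sup>2 + C\<^sup>2 = (\<Sum>i\<in>?I. (?u y i)\<^sup>2)"
    "\<And>f. f \<in> borel_measurable (borel \<Otimes>\<^sub>M borel) \<Longrightarrow>
      (\<integral>\<^sup>+\<xi>. f (\<Sum>i\<in>?I. ?u x i * \<xi> i, \<Sum>i\<in>?I. ?u y i * \<xi> i) \<partial>PiM ?I (\<lambda>_. gauss \<sigma>)) =
      (\<integral>\<^sup>+x. \<integral>\<^sup>+y. f (A * x, B * x + C * y) \<partial>gauss \<sigma> \<partial>gauss \<sigma>)"
    by (rule nn_integral_PiM_gauss_two_forms[OF \<sigma> fin, where u="?u x" and v="?u y"]) (rule that)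
  have "A > 0" using * L_pos unfolding sq by (metis less_le zero_power2 less_irrefl)
  then show ?thesis
    by (rule that[of A C B]) (use * law in \<open>simp_all only: sq cross\<close>)
qed

text \<open>The density of the process at a point is bounded, uniformly in the point.\<close>

lemma prob_process_small:
  obtains D where "\<And>x \<epsilon>. \<epsilon> \<ge> 0 \<Longrightarrow> prob {\<omega> \<in> space M. \<bar>process \<omega> x\<bar> \<le> \<epsilon>} \<le> D * \<epsilon>"
proof
  fix x \<epsilon> :: real assume \<epsilon>: "\<epsilon> \<ge> 0"
  interpret N: prob_space "gauss \<sigma>" using \<sigma> by (rule prob_space_gauss)
  define K where "K = 1 / sqrt (2 * pi * \<sigma>\<^sup>2)"
  have K: "normal_density 0 \<sigma> s \<le> K" for s
    using \<sigma> by (simp add: normal_density_def K_def divide_right_mono)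
  have K0: "K \<ge> 0" by (simp add: K_def)
  show "prob {\<omega> \<in> space M. \<bar>process \<omega> x\<bar> \<le> \<epsilon>} \<le> (1 / sqrt (2 * pi * \<sigma>\<^sup>2) * 2 / sqrt L) * \<epsilon>"
  proof (rule nn_integral_process_pair[of x x])
    fix A C B assume A: "A > 0" "A\<^sup>2 = L" and law: "\<And>f. f \<in> borel_measurable (borel \<Otimes>\<^sub>M borel) \<Longrightarrow> (\<integral>\<^sup>+\<omega>. f (process \<omega> x, process \<omega> x) \<partial>M) =
      (\<integral>\<^sup>+s. \<integral>\<^sup>+t. f (A * s, B * s + C * t) \<partial>gauss \<sigma> \<partial>gauss \<sigma>)"
    have sqrtL: "sqrt L = A" using A by (metis less_imp_le real_sqrt_unique)
    have "emeasure M {\<omega> \<in> space M. \<bar>process \<omega> x\<bar> \<le> \<epsilon>} = (\<integral>\<^sup>+\<omega>. indicator {\<omega> \<in> space M. \<bar>process \<omega> x\<bar> \<le> \<epsilon>} \<omega> \<partial>M)"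
      by (rule nn_integral_indicator[symmetric]) measurable
    also have "\<dots> = (\<integral>\<^sup>+\<omega>. indicator {(s, t). \<bar>s\<bar> \<le> \<epsilon>} (process \<omega> x, process \<omega> x) \<partial>M)"
      by (intro nn_integral_cong) (simp add: indicator_def)
    also have "\<dots> = (\<integral>\<^sup>+s. \<integral>\<^sup>+t. indicator {(s, t). \<bar>s\<bar> \<le> \<epsilon>} (A * s, B * s + C * t) \<partial>gauss \<sigma> \<partial>gauss \<sigma>)"
      by (rule law) measurable
    also have "\<dots> = (\<integral>\<^sup>+s. indicator {- \<epsilon> / A..\<epsilon> / A} s \<partial>gauss \<sigma>)"
      using N.emeasure_space_1 A by (intro nn_integral_cong) (auto simp: indicator_def abs_mult abs_le_iff field_simps)
    also have "\<dots> = (\<integral>\<^sup>+s. ennreal (normal_density 0 \<sigma> s) * indicator {- \<epsilon> / A..\<epsilon> / A} s \<partial>lborel)"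
      by (subst nn_integral_density) auto
    also have "\<dots> \<le> (\<integral>\<^sup>+s. ennreal K * indicator {- \<epsilon> / A..\<epsilon> / A} s \<partial>lborel)"
      by (intro nn_integral_mono mult_right_mono ennreal_leI K) simp
    also have "\<dots> = ennreal K * ennreal (\<epsilon> / A - (- \<epsilon> / A))"
      using A \<epsilon> by (simp add: nn_integral_cmult_indicator)
    also have "\<dots> = ennreal (K * 2 / sqrt L * \<epsilon>)"
      using K0 by (simp add: ennreal_mult'[symmetric] sqrtL field_simps)
    finally have "ennreal (prob {\<omega> \<in> space M. \<bar>process \<omega> x\<bar> \<le> \<epsilon>}) \<le> ennreal (K * 2 / sqrt L * \<epsilon>)"
      by (simp add: emeasure_eq_measure)
    then show ?thesis
      unfolding K_def[symmetric] using K0 \<epsilon> by (subst (asm) ennreal_le_iff) auto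
  qed
qed

lemma AE_process_nonzero: "AE \<omega> in M. process \<omega> x \<noteq> 0"
proof -
  obtain D where "\<And>x \<epsilon>. \<epsilon> \<ge> 0 \<Longrightarrow> prob {\<omega> \<in> space M. \<bar>process \<omega> x\<bar> \<le> \<epsilon>} \<le> D * \<epsilon>"
    using prob_process_small by blast
  from this[of 0 x] have "prob {\<omega> \<in> space M. \<bar>process \<omega> x\<bar> \<le> 0} = 0" by (simp add: antisym)
  then have "emeasure M {\<omega> \<in> space M. \<bar>process \<omega> x\<bar> \<le> 0} = 0" by (simp add: emeasure_eq_measure)
  then show ?thesis
    by (intro AE_I[where N="{\<omega> \<in> space M. \<bar>process \<omega> x\<bar> \<le> 0}"]) auto
qed

text \<open>Let \<open>N\<close> bound the second derivative. Near a double zero the process is at most \<open>N h\<^sup>2\<close> at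
  some point of the grid of mesh \<open>h\<close>. A given grid point has this property with probability
  \<open>O(h\<^sup>2)\<close>, and there are \<open>O(1 / h)\<close> grid points, so the event has probability
  \<open>O(h)\<close> for every \<open>h\<close>. The bound on the second derivative is random, so the argument is
  run for all natural numbers \<open>N\<close>.\<close>

lemma AE_no_double_zeros:
  assumes q: "q > 0"
  shows "AE \<omega> in M. \<forall>x\<in>{0..q}. process \<omega> x = 0 \<longrightarrow> process_deriv \<omega> x \<noteq> 0"
proof -
  obtain D where D: "\<And>x \<epsilon>. \<epsilon> \<ge> 0 \<Longrightarrow> prob {\<omega> \<in> space M. \<bar>process \<omega> x\<bar> \<le> \<epsilon>} \<le> D * \<epsilon>"
    using prob_process_small by blast
  let ?bad = "\<lambda>N k i. {\<omega> \<in> space M. \<bar>process \<omega> (q * real i / real k)\<bar> \<le> real N * (q / real k)\<^sup>2}"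
  have "AE \<omega> in M. \<exists>k. \<forall>i\<le>Suc k. \<omega> \<notin> ?bad N (Suc k) i" for N :: nat
  proof -
    let ?B = "{\<omega> \<in> space M. \<forall>k. \<exists>i\<in>{..Suc k}. \<bar>process \<omega> (q * real i / real (Suc k))\<bar> \<le> real N * (q / real (Suc k))\<^sup>2}"
    have [measurable]: "?B \<in> sets M" by measurable
    have le: "prob ?B \<le> real (k + 2) * (D * (real N * (q / real (k + 1))\<^sup>2))" for k
    proof -
      have "prob ?B \<le> prob (\<Union>i\<in>{..Suc k}. ?bad N (Suc k) i)"
        by (rule finite_measure_mono) auto
      also have "\<dots> \<le> (\<Sum>i\<in>{..Suc k}. prob (?bad N (Suc k) i))"
        by (rule finite_measure_subadditive_finite) auto
      also have "\<dots> \<le> (\<Sum>i\<in>{..Suc k}. D * (real N * (q / real (k + 1))\<^sup>2))"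
        by (intro sum_mono order_trans[OF D]) auto
      finally show ?thesis by simp
    qed
    have "(\<lambda>k. real (k + 2) * (D * (real N * (q / real (k + 1))\<^sup>2))) =
      (\<lambda>k. (D * real N * q\<^sup>2) * (real (k + 2) / (real (k + 1))\<^sup>2))"
      by (simp add: fun_eq_iff power_divide)
    moreover have "(\<lambda>k. real (k + 2) / (real (k + 1))\<^sup>2) \<longlonglongrightarrow> 0" by real_asymp
    ultimately have "(\<lambda>k. real (k + 2) * (D * (real N * (q / real (k + 1))\<^sup>2))) \<longlonglongrightarrow> 0"
      by (simp only: tendsto_mult_right_zero)
    then have "prob ?B \<le> 0"
      by (rule LIMSEQ_le_const) (use le in auto)
    then have "emeasure M ?B = 0" by (simp add: emeasure_eq_measure measure_le_0_iff)
    then show ?thesis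
    proof (intro AE_I[where N="?B"])
      show "{\<omega> \<in> space M. \<not> (\<exists>k. \<forall>i\<le>Suc k. \<omega> \<notin> ?bad N (Suc k) i)} \<subseteq> ?B"
      proof
        fix \<omega> assume "\<omega> \<in> {\<omega> \<in> space M. \<not> (\<exists>k. \<forall>i\<le>Suc k. \<omega> \<notin> ?bad N (Suc k) i)}"
        then have "\<omega> \<in> space M" "\<forall>k. \<exists>i\<le>Suc k. \<omega> \<in> ?bad N (Suc k) i" by blast+
        then show "\<omega> \<in> ?B" by blast
      qed
    qed auto
  qed
  then have "AE \<omega> in M. \<forall>N. \<exists>k. \<forall>i\<le>Suc k. \<omega> \<notin> ?bad N (Suc k) i"
    by (simp add: AE_all_countable)
  then show ?thesis
  proof (rule AE_mp, intro AE_I2 impI ballI notI)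
    fix \<omega> x
    assume \<omega>: "\<omega> \<in> space M" and good: "\<forall>N. \<exists>k. \<forall>i\<le>Suc k. \<omega> \<notin> ?bad N (Suc k) i"
      and x: "x \<in> {0..q}" and z: "process \<omega> x = 0" "process_deriv \<omega> x = 0"
    define K where "K = (\<Sum>j\<in>J. (\<theta> j)\<^sup>2 * (\<bar>a j \<omega>\<bar> + \<bar>b j \<omega>\<bar>))"
    obtain N :: nat where N: "K \<le> real N" using real_arch_simple by blast
    obtain k where k: "\<forall>i\<le>Suc k. \<omega> \<notin> ?bad N (Suc k) i" using good by blast
    \<comment> \<open>The index of the last grid point that does not exceed the double zero \<open>x\<close>.\<close>
    define i where "i = nat \<lfloor>real (Suc k) * x / q\<rfloor>"
    have nonneg: "0 \<le> real (Suc k) * x / q" using x q by auto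
    then have i: "real i = of_int \<lfloor>real (Suc k) * x / q\<rfloor>" by (simp add: i_def)
    have i1: "real i \<le> real (Suc k) * x / q" "real (Suc k) * x / q < real i + 1" unfolding i by linarith+
    have "real (Suc k) * x / q \<le> real (Suc k)" using x q by (simp add: divide_le_eq mult_left_mono)
    then have "real i \<le> real (Suc k)" using i1 by linarith
    then have iSk: "i \<le> Suc k" by simp
    have "q * real i / real (Suc k) \<le> x" "x \<le> q * (real i + 1) / real (Suc k)"
      using i1 q by (simp_all add: field_simps)
    moreover have "q * (real i + 1) / real (Suc k) = q * real i / real (Suc k) + q / real (Suc k)"
      by (simp only: distrib_left add_divide_distrib mult_1_right)
    ultimately have "\<bar>q * real i / real (Suc k) - x\<bar> \<le> q / real (Suc k)" by linarith
    then have dist: "(q * real i / real (Suc k) - x)\<^sup>2 \<le> (q / real (Suc k))\<^sup>2"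
      using q by (subst power2_le_iff_abs_le) auto
    have "\<bar>process \<omega> (q * real i / real (Suc k))\<bar> \<le> K * (q * real i / real (Suc k) - x)\<^sup>2"
      unfolding K_def by (rule double_zero_bound[OF z])
    also have "\<dots> \<le> real N * (q / real (Suc k))\<^sup>2" by (intro mult_mono N dist) auto
    finally show False using k iSk \<omega> by auto
  qed
qed

text \<open>The arctangent is the angle whose cosine is the correlation \<open>kernel h / L\<close>. In this form it is
  small together with its argument, which suits the limit \<open>h \<rightarrow> 0\<close>.\<close>

lemma prob_sign_change:
  assumes h: "0 < kernel h" "kernel h < L"
  shows "emeasure M {\<omega> \<in> space M. process \<omega> x * process \<omega> (x + h) < 0} = ennreal (arctan (sqrt (L\<^sup>2 - (kernel h)\<^sup>2) / kernel h) / pi)"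
proof (rule nn_integral_process_pair[of "x + h" x])
  fix A C B assume A: "A > 0" "A\<^sup>2 = L" and "C \<le> 0" and "A * B = kernel (x + h - x)" and C: "B\<^sup>2 + C\<^sup>2 = L"
    and law: "\<And>f. f \<in> borel_measurable (borel \<Otimes>\<^sub>M borel) \<Longrightarrow> (\<integral>\<^sup>+\<omega>. f (process \<omega> x, process \<omega> (x + h)) \<partial>M) =
      (\<integral>\<^sup>+s. \<integral>\<^sup>+t. f (A * s, B * s + C * t) \<partial>gauss \<sigma> \<partial>gauss \<sigma>)"
  define d where "d = - C"
  have AB: "A * B = kernel h" using \<open>A * B = kernel (x + h - x)\<close> by simp
  have B: "B > 0" using AB A h by (metis zero_less_mult_pos)
  have Ad: "(A * d)\<^sup>2 = L\<^sup>2 - (kernel h)\<^sup>2"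
  proof -
    have "(A * d)\<^sup>2 = A\<^sup>2 * (L - B\<^sup>2)" using C by (simp add: d_def power_mult_distrib)
    also have "\<dots> = L\<^sup>2 - (A * B)\<^sup>2" unfolding power_mult_distrib A(2) by (simp add: power2_eq_square algebra_simps)
    finally show ?thesis by (simp add: AB)
  qed
  have "(kernel h)\<^sup>2 < L\<^sup>2" using h by (intro power_strict_mono) auto
  then have "d \<noteq> 0" using Ad by auto
  then have d: "d > 0" using \<open>C \<le> 0\<close> by (simp add: d_def)
  have Ad': "A * d = sqrt (L\<^sup>2 - (kernel h)\<^sup>2)" using Ad A d by (metis less_imp_le mult_pos_pos real_sqrt_unique)
  have "emeasure M {\<omega> \<in> space M. process \<omega> x * process \<omega> (x + h) < 0} = (\<integral>\<^sup>+\<omega>. indicator {\<omega> \<in> space M. process \<omega> x * process \<omega> (x + h) < 0} \<omega> \<partial>M)"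
    by (rule nn_integral_indicator[symmetric]) measurable
  also have "\<dots> = (\<integral>\<^sup>+\<omega>. indicator {(s, t). s * t < 0} (process \<omega> x, process \<omega> (x + h)) \<partial>M)"
    by (intro nn_integral_cong) (simp add: indicator_def)
  also have "\<dots> = (\<integral>\<^sup>+s. \<integral>\<^sup>+t. indicator {(s, t). s * t < 0} (A * s, B * s + C * t) \<partial>gauss \<sigma> \<partial>gauss \<sigma>)"
    by (rule law) measurable
  also have "\<dots> = (\<integral>\<^sup>+s. \<integral>\<^sup>+t. indicator {(s, t). s * (B * s - d * t) < 0} (s, t) \<partial>gauss \<sigma> \<partial>gauss \<sigma>)"
    using A by (simp add: indicator_def d_def mult.assoc mult_less_0_iff zero_less_mult_iff)
  also have "\<dots> = ennreal ((pi / 2 - arctan (B / d)) / pi)"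
    by (rule emeasure_gauss_sector[OF \<sigma> d])
  also have "pi / 2 - arctan (B / d) = arctan (d / B)"
    using arctan_inverse[of "B / d"] B d by simp
  also have "d / B = sqrt (L\<^sup>2 - (kernel h)\<^sup>2) / kernel h"
    unfolding AB[symmetric] using A by (simp add: Ad'[unfolded AB[symmetric], symmetric])
  finally show ?thesis .
qed

text \<open>The kernel has the expansion \<open>L - h\<^sup>2 / 2 * (\<Sum>j\<in>J. (\<theta> j)\<^sup>2) + o(h\<^sup>2)\<close> at 0, so
  \<open>L\<^sup>2 - (kernel h)\<^sup>2\<close> is asymptotic to \<open>h\<^sup>2 L\<close> times the sum of the squared
  frequencies, and the arctangent can be replaced by its argument.\<close>

lemma tendsto_expected_sign_changes:
  assumes q: "q > 0"
  shows "\<forall>\<^sub>F k in sequentially. 0 < kernel (q / real k) \<and> kernel (q / real k) < L"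
    and "(\<lambda>k. real k * arctan (sqrt (L\<^sup>2 - (kernel (q / real k))\<^sup>2) / kernel (q / real k)))
      \<longlonglongrightarrow> q * sqrt ((\<Sum>j\<in>J. (\<theta> j)\<^sup>2) / L)"
proof -
  define S where "S = (\<Sum>j\<in>J. (\<theta> j)\<^sup>2)"
  let ?\<kappa> = "\<lambda>k. kernel (q / real k)"
  have S: "S > 0"
    unfolding S_def using \<theta>_nonzero finite_J by (auto intro!: sum_pos2)
  have second: "(\<lambda>k. (real k)\<^sup>2 * (L - ?\<kappa> k)) \<longlonglongrightarrow> q\<^sup>2 * S / 2"
  proof -
    have "(\<lambda>k. \<Sum>j\<in>J. (real k)\<^sup>2 * (1 - cos ((\<theta> j * q) / real k))) \<longlonglongrightarrow> (\<Sum>j\<in>J. (\<theta> j * q)\<^sup>2 / 2)"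
      by (intro tendsto_sum tendsto_second_difference_cos)
    moreover have "(\<Sum>j\<in>J. (real k)\<^sup>2 * (1 - cos ((\<theta> j * q) / real k))) = (real k)\<^sup>2 * (L - ?\<kappa> k)" for k
      by (simp add: kernel_def sum_distrib_left[symmetric] sum_subtractf)
    moreover have "(\<Sum>j\<in>J. (\<theta> j * q)\<^sup>2 / 2) = q\<^sup>2 * S / 2"
      by (simp add: S_def sum_distrib_left sum_divide_distrib power_mult_distrib mult.commute)
    ultimately show ?thesis by simp
  qed
  have kernel_lim: "?\<kappa> \<longlonglongrightarrow> L"
  proof -
    have "?\<kappa> \<longlonglongrightarrow> (\<Sum>j\<in>J. cos (\<theta> j * 0))"
      unfolding kernel_def by (intro tendsto_intros lim_const_over_n)
    then show ?thesis by simp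
  qed
  have lower: "\<forall>\<^sub>F k in sequentially. 0 < ?\<kappa> k"
    using kernel_lim L_pos by (rule order_tendstoD)
  have "q\<^sup>2 * S / 2 > 0" using q S by simp
  then have upper: "\<forall>\<^sub>F k in sequentially. 0 < (real k)\<^sup>2 * (L - ?\<kappa> k)"
    using second by (auto intro: order_tendstoD)
  show ev: "\<forall>\<^sub>F k in sequentially. 0 < ?\<kappa> k \<and> ?\<kappa> k < L"
    using lower upper by eventually_elim (auto simp: zero_less_mult_iff)
  let ?g = "\<lambda>k. sqrt (L\<^sup>2 - (?\<kappa> k)\<^sup>2) / ?\<kappa> k"
  have "(\<lambda>k. sqrt (((real k)\<^sup>2 * (L - ?\<kappa> k)) * (L + ?\<kappa> k)) / ?\<kappa> k) \<longlonglongrightarrow> sqrt ((q\<^sup>2 * S / 2) * (L + L)) / L"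
    using L_pos by (intro tendsto_intros second kernel_lim) auto
  moreover have "sqrt (((real k)\<^sup>2 * (L - ?\<kappa> k)) * (L + ?\<kappa> k)) / ?\<kappa> k = real k * ?g k" for k
  proof -
    have "((real k)\<^sup>2 * (L - ?\<kappa> k)) * (L + ?\<kappa> k) = (real k)\<^sup>2 * (L\<^sup>2 - (?\<kappa> k)\<^sup>2)"
      by (simp add: power2_eq_square algebra_simps)
    then have "sqrt (((real k)\<^sup>2 * (L - ?\<kappa> k)) * (L + ?\<kappa> k)) = sqrt ((real k)\<^sup>2 * (L\<^sup>2 - (?\<kappa> k)\<^sup>2))"
      by (rule arg_cong)
    also have "\<dots> = real k * sqrt (L\<^sup>2 - (?\<kappa> k)\<^sup>2)"
      by (simp add: real_sqrt_mult)
    finally show ?thesis by simp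
  qed
  moreover have "sqrt ((q\<^sup>2 * S / 2) * (L + L)) / L = q * sqrt (S / L)"
  proof -
    have "(q\<^sup>2 * S / 2) * (L + L) = q\<^sup>2 * (S / L) * L\<^sup>2" using L_pos by (simp add: power2_eq_square)
    then have "sqrt ((q\<^sup>2 * S / 2) * (L + L)) = sqrt (q\<^sup>2 * (S / L) * L\<^sup>2)" by (rule arg_cong)
    also have "\<dots> = q * sqrt (S / L) * L" using q by (simp only: real_sqrt_mult real_sqrt_abs abs_of_pos abs_of_nat)
    finally show ?thesis using L_pos by simp
  qed
  ultimately have kg: "(\<lambda>k. real k * ?g k) \<longlonglongrightarrow> q * sqrt (S / L)" by simp
  have "?g \<longlonglongrightarrow> sqrt (L\<^sup>2 - L\<^sup>2) / L"
    using L_pos by (intro tendsto_intros kernel_lim) auto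
  then have g0: "?g \<longlonglongrightarrow> 0" by simp
  have g_pos: "\<forall>\<^sub>F k in sequentially. ?g k \<noteq> 0"
    using ev
  proof eventually_elim
    case (elim k)
    then have "(?\<kappa> k)\<^sup>2 < L\<^sup>2" by (intro power_strict_mono) auto
    then show ?case using elim by auto
  qed
  have "((\<lambda>t. arctan t / t) \<longlongrightarrow> 1) (at (0::real))" by real_asymp
  moreover have "filterlim ?g (at 0) sequentially"
    unfolding filterlim_at using g0 g_pos by simp
  ultimately have "(\<lambda>k. arctan (?g k) / ?g k) \<longlonglongrightarrow> 1"
    by (rule filterlim_compose)
  from tendsto_mult[OF this kg] have "(\<lambda>k. (arctan (?g k) / ?g k) * (real k * ?g k)) \<longlonglongrightarrow> q * sqrt (S / L)" by simp
  moreover have "\<forall>\<^sub>F k in sequentially. (arctan (?g k) / ?g k) * (real k * ?g k) = real k * arctan (?g k)"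
    using g_pos by eventually_elim (simp add: field_simps)
  ultimately show "(\<lambda>k. real k * arctan (?g k)) \<longlonglongrightarrow> q * sqrt (S / L)"
    by (rule Lim_transform_eventually)
qed

lemma sign_changes_process_eq_sum:
  assumes "\<omega> \<in> space M"
  shows "(of_nat (sign_changes q k (process \<omega>)) :: ennreal) = (\<Sum>i<k. indicator
    {\<omega> \<in> space M. process \<omega> (q * real i / real k) * process \<omega> (q * real (Suc i) / real k) < 0} \<omega>)"
  using assms by (simp add: sign_changes_def indicator_def of_bool_def sum.If_cases Int_def)

lemma nn_integral_sign_changes:
  assumes k: "0 < kernel (q / real k)" "kernel (q / real k) < L"
  shows "(\<integral>\<^sup>+\<omega>. of_nat (sign_changes q k (process \<omega>)) \<partial>M) =
    ennreal (real k * arctan (sqrt (L\<^sup>2 - (kernel (q / real k))\<^sup>2) / kernel (q / real k)) / pi)"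
proof -
  let ?E = "\<lambda>i. {\<omega> \<in> space M. process \<omega> (q * real i / real k) * process \<omega> (q * real (Suc i) / real k) < 0}"
  have "(\<integral>\<^sup>+\<omega>. of_nat (sign_changes q k (process \<omega>)) \<partial>M) = (\<integral>\<^sup>+\<omega>. (\<Sum>i<k. indicator (?E i) \<omega>) \<partial>M)"
    by (rule nn_integral_cong) (rule sign_changes_process_eq_sum)
  also have "\<dots> = (\<Sum>i<k. emeasure M (?E i))"
    by (subst nn_integral_sum) auto
  also have "\<dots> = (\<Sum>i<k. ennreal (arctan (sqrt (L\<^sup>2 - (kernel (q / real k))\<^sup>2) / kernel (q / real k)) / pi))"
  proof (rule sum.cong)
    fix i
    have "q * real (Suc i) / real k = q * real i / real k + q / real k"
      by (simp add: field_simps add_divide_distrib)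
    then show "emeasure M (?E i) = ennreal (arctan (sqrt (L\<^sup>2 - (kernel (q / real k))\<^sup>2) / kernel (q / real k)) / pi)"
      using prob_sign_change[OF k] by simp
  qed simp
  also have "\<dots> = ennreal (real k * arctan (sqrt (L\<^sup>2 - (kernel (q / real k))\<^sup>2) / kernel (q / real k)) / pi)"
    by (simp add: ennreal_of_nat_eq_real_of_nat ennreal_mult'[symmetric])
  finally show ?thesis .
qed

text \<open>Rice's formula. The number of sign changes is at most the number of zeros, so the limit of
  its mean is a lower bound, and Fatou's lemma turns the eventual equality of the two numbers into the
  matching upper bound.\<close>

theorem expected_zeros:
  assumes q: "q > 0"
  shows "AE \<omega> in M. finite {x \<in> {0<..<q}. process \<omega> x = 0}"
    and "(\<integral>\<^sup>+\<omega>. of_nat (card {x \<in> {0<..<q}. process \<omega> x = 0}) \<partial>M) = ennreal (q / pi * sqrt ((\<Sum>j\<in>J. (\<theta> j)\<^sup>2) / L))"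
proof -
  let ?Z = "\<lambda>\<omega>. {x \<in> {0<..<q}. process \<omega> x = 0}"
  let ?N = "\<lambda>\<omega>. of_nat (card (?Z \<omega>)) :: ennreal"
  let ?S = "\<lambda>k \<omega>. of_nat (sign_changes q k (process \<omega>)) :: ennreal"
  let ?E = "ennreal (q / pi * sqrt ((\<Sum>j\<in>J. (\<theta> j)\<^sup>2) / L))"
  have "AE \<omega> in M. \<forall>i k. process \<omega> (q * real i / real k) \<noteq> 0"
    by (simp add: AE_all_countable AE_process_nonzero)
  with AE_no_double_zeros[OF q]
  have gen: "AE \<omega> in M. finite (?Z \<omega>) \<and> (\<forall>\<^sub>F k in sequentially. card (?Z \<omega>) \<le> sign_changes q k (process \<omega>))"
  proof eventually_elim
    case (elim \<omega>)
    have "finite {x \<in> {0..q}. process \<omega> x = 0}"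
      by (rule finite_zeros_if_simple[OF DERIV_process]) (use elim in blast)
    then have "finite (?Z \<omega>)" by (rule finite_subset[rotated]) auto
    moreover have "\<forall>\<^sub>F k in sequentially. card (?Z \<omega>) \<le> sign_changes q k (process \<omega>)"
      by (rule eventually_card_zeros_le_sign_changes[OF DERIV_process q]) (use elim in blast)+
    ultimately show ?case ..
  qed
  then show "AE \<omega> in M. finite (?Z \<omega>)" by eventually_elim simp
  have lim: "(\<lambda>k. integral\<^sup>N M (?S k)) \<longlonglongrightarrow> ?E"
  proof (rule Lim_transform_eventually)
    let ?e = "\<lambda>k. real k * arctan (sqrt (L\<^sup>2 - (kernel (q / real k))\<^sup>2) / kernel (q / real k)) / pi"
    have "?e \<longlonglongrightarrow> q * sqrt ((\<Sum>j\<in>J. (\<theta> j)\<^sup>2) / L) / pi"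
      using tendsto_divide[OF tendsto_expected_sign_changes(2)[OF q] tendsto_const[of pi]] by simp
    then show "(\<lambda>k. ennreal (?e k)) \<longlonglongrightarrow> ?E" by (intro tendsto_ennrealI) simp
    show "\<forall>\<^sub>F k in sequentially. ennreal (?e k) = integral\<^sup>N M (?S k)"
      using tendsto_expected_sign_changes(1)[OF q]
      by eventually_elim (simp add: nn_integral_sign_changes)
  qed
  have [measurable]: "?S k \<in> borel_measurable M" for k
    by (subst measurable_cong[OF sign_changes_process_eq_sum], assumption) measurable
  show "(\<integral>\<^sup>+\<omega>. ?N \<omega> \<partial>M) = ?E"
  proof (rule antisym)
    have "(\<integral>\<^sup>+\<omega>. ?N \<omega> \<partial>M) \<le> (\<integral>\<^sup>+\<omega>. liminf (\<lambda>k. ?S k \<omega>) \<partial>M)"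
    proof (rule nn_integral_mono_AE)
      show "AE \<omega> in M. ?N \<omega> \<le> liminf (\<lambda>k. ?S k \<omega>)"
        using gen
      proof eventually_elim
        case (elim \<omega>)
        then have "\<forall>\<^sub>F k in sequentially. ?N \<omega> \<le> ?S k \<omega>" by (auto elim: eventually_mono)
        then show ?case by (rule Liminf_bounded)
      qed
    qed
    also have "\<dots> \<le> liminf (\<lambda>k. integral\<^sup>N M (?S k))"
      by (rule nn_integral_liminf) measurable
    also have "\<dots> = ?E" using lim by (simp add: lim_imp_Liminf)
    finally show "(\<integral>\<^sup>+\<omega>. ?N \<omega> \<partial>M) \<le> ?E" .
  next
    have "integral\<^sup>N M (?S k) \<le> (\<integral>\<^sup>+\<omega>. ?N \<omega> \<partial>M)" for k
    proof (rule nn_integral_mono_AE)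
      show "AE \<omega> in M. ?S k \<omega> \<le> ?N \<omega>"
        using gen by eventually_elim (use sign_changes_le_card_zeros[OF continuous_process q] in auto)
    qed
    then show "?E \<le> (\<integral>\<^sup>+\<omega>. ?N \<omega> \<partial>M)"
      using lim by (intro LIMSEQ_le_const2[OF lim]) auto
  qed
qed

end

section \<open>Factorization of a trigonometric polynomial with periodic coefficients\<close>

lemma sum_lessThan_mult:
  fixes f :: "nat \<Rightarrow> 'a :: comm_monoid_add"
  shows "sum f {..<l * m} = (\<Sum>k<m. \<Sum>j<l. f (j + l * k))"
proof (induction m)
  case (Suc m)
  have "sum f {..<l * Suc m} = sum f {..<l * m} + sum f {0 + l * m..<l + l * m}"
    using sum.atLeastLessThan_concat[of 0 "l * m" "l * m + l" f]
    by (simp add: lessThan_atLeast0 add.commute)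
  also have "sum f {0 + l * m..<l + l * m} = (\<Sum>j<l. f (j + l * m))"
    by (simp only: sum.shift_bounds_nat_ivl lessThan_atLeast0)
  finally show ?case using Suc by simp
qed simp

lemma periodic_upto_mult:
  assumes "periodic_upto l n c" "j + l * k \<le> n"
  shows "c (j + l * k) = c j"
  using assms(2)
proof (induction k)
  case (Suc k)
  then have "j + l * k + l \<le> n" by simp
  then have "c (j + l * k + l) = c (j + l * k)" using assms(1) unfolding periodic_upto_def by blast
  then show ?case using Suc by (simp add: add_ac)
qed simp

text \<open>The Dirichlet kernel of the block sums: \<open>dirichlet_factor l m x\<close> equals
  \<open>sin (l m x / 2) / sin (l x / 2)\<close> where the denominator does not vanish. The sum of cosines has no
  exceptional points.\<close>

definition dirichlet_factor :: "nat \<Rightarrow> nat \<Rightarrow> real \<Rightarrow> real" where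
  "dirichlet_factor l m x = (\<Sum>k<m. cos (real l * (real k - (real m - 1) / 2) * x))"

definition centred_freq :: "nat \<Rightarrow> nat \<Rightarrow> nat \<Rightarrow> real" where
  "centred_freq l m j = real l * (real m - 1) / 2 + real j"

lemma sum_sin_symmetric_zero:
  "(\<Sum>k<m. sin (c * (real k - (real m - 1) / 2))) = 0"
proof -
  let ?g = "\<lambda>k. sin (c * (real k - (real m - 1) / 2))"
  have "?g (m - Suc k) = - ?g k" if "k < m" for k
  proof -
    have "c * (real (m - Suc k) - (real m - 1) / 2) = - (c * (real k - (real m - 1) / 2))"
      using that by (simp add: of_nat_diff field_simps)
    then show ?thesis by simp
  qed
  then have "(\<Sum>k<m. ?g (m - Suc k)) = - (\<Sum>k<m. ?g k)"
    by (simp add: sum_negf)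
  then show ?thesis using sum.nat_diff_reindex[of ?g m] by simp
qed

text \<open>Write the frequency \<open>j + l k\<close> of the \<open>j\<close>-th term in the \<open>k\<close>-th block as the centred
  frequency plus \<open>l (k - (m - 1) / 2)\<close> and use the addition theorems. The shifts are symmetric
  about 0, so the terms with their sines cancel in the sum over \<open>k\<close>.\<close>

lemma trig_poly_periodic_factorization:
  assumes l: "l \<ge> 1" and m: "m \<ge> 1" and n: "n = l * m - 1"
    and A: "periodic_upto l n A" and B: "periodic_upto l n B"
  shows "trig_poly n A B x = dirichlet_factor l m x *
    (\<Sum>j<l. A j * cos (centred_freq l m j * x) + B j * sin (centred_freq l m j * x))"
proof -
  let ?\<theta> = "centred_freq l m"
  let ?\<delta> = "\<lambda>k. real l * (real k - (real m - 1) / 2)"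
  let ?Y = "\<Sum>j<l. A j * cos (?\<theta> j * x) + B j * sin (?\<theta> j * x)"
  let ?H = "\<Sum>j<l. B j * cos (?\<theta> j * x) - A j * sin (?\<theta> j * x)"
  have "l * m > 0" using l m by simp
  then have "Suc n = l * m" using n by simp
  then have "{..n} = {..<l * m}" by (metis lessThan_Suc_atMost)
  then have "trig_poly n A B x = (\<Sum>k<m. \<Sum>j<l. A (j + l * k) * cos (real (j + l * k) * x) + B (j + l * k) * sin (real (j + l * k) * x))"
    by (simp only: trig_poly_def sum_lessThan_mult)
  also have "\<dots> = (\<Sum>k<m. \<Sum>j<l. cos (?\<delta> k * x) * (A j * cos (?\<theta> j * x) + B j * sin (?\<theta> j * x)) +
      sin (?\<delta> k * x) * (B j * cos (?\<theta> j * x) - A j * sin (?\<theta> j * x)))"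
  proof (intro sum.cong refl)
    fix k j assume kj: "k \<in> {..<m}" "j \<in> {..<l}"
    then have "l * Suc k \<le> l * m" by (intro mult_left_mono) auto
    then have le: "j + l * k \<le> n" using kj n by simp
    have arg: "real (j + l * k) * x = ?\<theta> j * x + ?\<delta> k * x"
      by (simp add: centred_freq_def field_simps)
    show "A (j + l * k) * cos (real (j + l * k) * x) + B (j + l * k) * sin (real (j + l * k) * x) =
      cos (?\<delta> k * x) * (A j * cos (?\<theta> j * x) + B j * sin (?\<theta> j * x)) +
      sin (?\<delta> k * x) * (B j * cos (?\<theta> j * x) - A j * sin (?\<theta> j * x))"
      unfolding periodic_upto_mult[OF A le] periodic_upto_mult[OF B le] arg cos_add sin_add
      by (simp add: algebra_simps)
  qed
  also have "\<dots> = (\<Sum>k<m. cos (?\<delta> k * x) * ?Y + sin (?\<delta> k * x) * ?H)"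
    by (simp only: sum_distrib_left sum.distrib[symmetric])
  also have "\<dots> = dirichlet_factor l m x * ?Y + (\<Sum>k<m. sin (?\<delta> k * x)) * ?H"
    by (simp only: sum.distrib sum_distrib_right dirichlet_factor_def)
  also have "(\<Sum>k<m. sin (?\<delta> k * x)) = 0"
    using sum_sin_symmetric_zero[of "real l * x" m] by (simp only: mult_ac)
  finally show ?thesis by simp
qed

text \<open>Twice the left side telescopes by the product-to-sum formula.\<close>

lemma sin_mult_dirichlet_factor:
  "sin (real l * x / 2) * dirichlet_factor l m x = sin (real l * real m * x / 2)"
proof -
  let ?g = "\<lambda>k. sin (real l * (real k - real m / 2) * x)"
  have "2 * (sin (real l * x / 2) * cos (real l * (real k - (real m - 1) / 2) * x)) = ?g (Suc k) - ?g k" for k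
  proof -
    have e: "real l * (real (Suc k) - real m / 2) * x = real l * (real k - (real m - 1) / 2) * x + real l * x / 2"
      "real l * (real k - real m / 2) * x = real l * (real k - (real m - 1) / 2) * x - real l * x / 2"
      by (simp_all add: field_simps)
    show ?thesis unfolding e sin_add sin_diff by simp
  qed
  then have "2 * (sin (real l * x / 2) * dirichlet_factor l m x) = (\<Sum>k<m. ?g (Suc k) - ?g k)"
    unfolding dirichlet_factor_def sum_distrib_left by simp
  also have "\<dots> = ?g m - ?g 0" by (rule sum_lessThan_telescope)
  also have "?g m = sin (real l * real m * x / 2)" by (simp add: field_simps)
  also have "?g 0 = - sin (real l * real m * x / 2)" by simp
  finally show ?thesis by simp
qed

text \<open>By the previous lemma a zero of the factor is a zero \<open>2 pi k / (l m)\<close> of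
  \<open>sin (l m x / 2)\<close>. At such a point \<open>sin (l x / 2)\<close> vanishes exactly if \<open>m dvd k\<close>, and then
  all cosines in the sum have the same value 1 or - 1, so the factor is \<open>m\<close> or \<open>- m\<close>.\<close>

lemma dirichlet_factor_zeros:
  assumes l: "l \<ge> 1" and m: "m \<ge> 1"
  shows "{x \<in> {0<..<2 * pi}. dirichlet_factor l m x = 0} =
    (\<lambda>k. 2 * pi * real k / real (l * m)) ` {k \<in> {..<l * m}. \<not> m dvd k}" (is "?L = ?R")
proof
  have lm: "real (l * m) > 0" using l m by simp
  show "?L \<subseteq> ?R"
  proof
    fix x assume x: "x \<in> ?L"
    then have "sin (real l * real m * x / 2) = 0" using sin_mult_dirichlet_factor[of l x m] by simp
    then obtain i :: int where i: "real l * real m * x / 2 = of_int i * pi" by (auto simp: sin_zero_iff_int2)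
    then have xi: "x = 2 * pi * of_int i / real (l * m)"
      using l m by (simp add: field_simps)
    have "0 < of_int i * pi" unfolding i[symmetric] using x lm by simp
    then have i0: "i > 0" by (simp add: zero_less_mult_iff)
    have "2 * pi * of_int i < 2 * pi * real (l * m)" using x lm unfolding xi by (simp add: divide_less_eq)
    then have "of_int i < real (l * m)" by simp
    then have ilm: "i < int (l * m)" by (metis of_int_less_iff of_int_of_nat_eq)
    define k where "k = nat i"
    have k: "i = int k" using i0 by (simp add: k_def)
    have "\<not> m dvd k"
    proof
      assume "m dvd k"
      then obtain r where r: "k = m * r" by auto
      have xr: "x = 2 * pi * real r / real l" unfolding xi k r using m by simp
      have "cos (real l * (real t - (real m - 1) / 2) * x) = (-1) ^ (r * (m - 1))" for t :: nat
      proof -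
        have "real l * (real t - (real m - 1) / 2) * x = 2 * real (t * r) * pi - real (r * (m - 1)) * pi"
          unfolding xr using l m by (simp add: field_simps of_nat_diff)
        then show ?thesis by (simp only: cos_diff cos_2npi sin_2npi cos_npi mult_1_left mult_zero_left add_0_right)
      qed
      then have "dirichlet_factor l m x = real m * (-1) ^ (r * (m - 1))" by (simp add: dirichlet_factor_def)
      then show False using x m by auto
    qed
    moreover have "k < l * m" using ilm unfolding k by (simp only: of_nat_less_iff)
    ultimately show "x \<in> ?R" using xi by (intro image_eqI[of _ _ k]) (auto simp: k)
  qed
  show "?R \<subseteq> ?L"
  proof (rule image_subsetI)
    fix k assume "k \<in> {k \<in> {..<l * m}. \<not> m dvd k}"
    then have k: "k < l * m" "\<not> m dvd k" by auto
    let ?x = "2 * pi * real k / real (l * m)"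
    have k0: "k > 0" using k by (cases k) auto
    have "real l * real m * ?x / 2 = real k * pi" using l m by (simp add: field_simps)
    then have "sin (real l * real m * ?x / 2) = 0" by simp
    then have "sin (real l * ?x / 2) * dirichlet_factor l m ?x = 0" using sin_mult_dirichlet_factor[of l ?x m] by simp
    moreover have "sin (real l * ?x / 2) \<noteq> 0"
    proof
      assume "sin (real l * ?x / 2) = 0"
      then obtain i :: int where "real l * ?x / 2 = of_int i * pi" by (auto simp: sin_zero_iff_int2)
      then have "real k * pi = of_int (i * int m) * pi" using l m by (simp add: field_simps)
      then have "real k = of_int (i * int m)" by simp
      then have "int k = i * int m" by (metis of_int_eq_iff of_int_of_nat_eq)
      then have "int m dvd int k" by simp
      then show False using k by simp
    qed
    ultimately have "dirichlet_factor l m ?x = 0" by simp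
    moreover have "0 < ?x" using k0 lm by (intro divide_pos_pos mult_pos_pos) auto
    moreover have "?x < 2 * pi"
    proof -
      have "real k < real (l * m)" using k(1) by (simp only: of_nat_less_iff)
      then have "2 * pi * real k < 2 * pi * real (l * m)" by (intro mult_strict_left_mono) auto
      then show ?thesis using lm by (simp only: divide_less_eq if_True)
    qed
    ultimately show "?x \<in> ?L" by simp
  qed
qed

lemma card_dirichlet_factor_zeros:
  assumes l: "l \<ge> 1" and m: "m \<ge> 1"
  shows "finite {x \<in> {0<..<2 * pi}. dirichlet_factor l m x = 0}"
    and "card {x \<in> {0<..<2 * pi}. dirichlet_factor l m x = 0} = l * m - l"
proof -
  show "finite {x \<in> {0<..<2 * pi}. dirichlet_factor l m x = 0}"
    unfolding dirichlet_factor_zeros[OF assms] by simp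
  have "{k \<in> {..<l * m}. \<not> m dvd k} = {..<l * m} - (\<lambda>i. m * i) ` {..<l}"
    using m by (auto simp: dvd_def mult.commute)
  also have "card \<dots> = l * m - l"
    using m by (subst card_Diff_subset) (auto simp: card_image inj_on_def mult.commute)
  finally have c: "card {k \<in> {..<l * m}. \<not> m dvd k} = l * m - l" .
  have "inj_on (\<lambda>k. 2 * pi * real k / real (l * m)) {k \<in> {..<l * m}. \<not> m dvd k}"
    using l m by (auto simp: inj_on_def)
  then show "card {x \<in> {0<..<2 * pi}. dirichlet_factor l m x = 0} = l * m - l"
    unfolding dirichlet_factor_zeros[OF assms] using c by (simp only: card_image)
qed

text \<open>Second moment of \<open>l\<close> equally spaced points: their mean is \<open>c + (l - 1) / 2\<close> and their variance
  \<open>(l\<^sup>2 - 1) / 12\<close>.\<close>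

lemma sum_shifted_squares:
  "(\<Sum>j<l. (c + real j)\<^sup>2) = real l * ((c + (real l - 1) / 2)\<^sup>2 + ((real l)\<^sup>2 - 1) / 12)"
  by (induction l) (simp_all add: power2_eq_square field_simps)

section \<open>Expected number of zeros\<close>

theorem theorem2p1:
  fixes M :: "'w measure"
    and a b :: "nat \<Rightarrow> 'w \<Rightarrow> real"
    and l m n :: nat
    and \<sigma> :: real
  defines "T \<equiv> (\<lambda>\<omega>. trig_poly n (\<lambda>j. a j \<omega>) (\<lambda>j. b j \<omega>))"
  assumes "prob_space M"
    and "l \<ge> 1" and "m \<ge> 2" and "n = l * m - 1"
    and "\<sigma> > 0"
    and "prob_space.indep_vars M (\<lambda>_. borel) (case_sum a b) ({..<l} <+> {..<l})"
    and "\<And>i. i < l \<Longrightarrow> distributed M lborel (a i) (normal_density 0 \<sigma>)"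
    and "\<And>i. i < l \<Longrightarrow> distributed M lborel (b i) (normal_density 0 \<sigma>)"
    and "\<And>\<omega>. \<omega> \<in> space M \<Longrightarrow> periodic_upto l n (\<lambda>j. a j \<omega>)"
    and "\<And>\<omega>. \<omega> \<in> space M \<Longrightarrow> periodic_upto l n (\<lambda>j. b j \<omega>)"
  shows "(AE \<omega> in M. finite (zeros_on {0<..<2 * pi} (T \<omega>))) \<and>
    integrable M (\<lambda>\<omega>. real (num_zeros {0<..<2 * pi} (T \<omega>))) \<and>
    prob_space.expectation M (\<lambda>\<omega>. real (num_zeros {0<..<2 * pi} (T \<omega>)))
      = real n + 1 - real l + sqrt ((real n)\<^sup>2 + ((real l)\<^sup>2 - 1) / 3)"
proof -
  let ?\<theta> = "centred_freq l m"
  let ?D = "dirichlet_factor l m"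
  interpret prob_space M by fact
  have m1: "m \<ge> 1" using \<open>m \<ge> 2\<close> by simp
  have "?\<theta> 0 > 0" using \<open>l \<ge> 1\<close> \<open>m \<ge> 2\<close> by (simp add: centred_freq_def)
  then have "\<exists>j\<in>{..<l}. ?\<theta> j \<noteq> 0" using \<open>l \<ge> 1\<close> by (intro bexI[of _ 0]) auto
  then interpret G: gaussian_trig_sum M \<sigma> "{..<l}" ?\<theta> a b
    by unfold_locales (use assms in auto)
  have T: "T \<omega> x = ?D x * G.process \<omega> x" if "\<omega> \<in> space M" for \<omega> x
    unfolding T_def G.process_def
    by (rule trig_poly_periodic_factorization) (use assms m1 that in auto)
  let ?ZT = "\<lambda>\<omega>. zeros_on {0<..<2 * pi} (T \<omega>)"
  let ?ZY = "\<lambda>\<omega>. {x \<in> {0<..<2 * pi}. G.process \<omega> x = 0}"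
  let ?ZD = "{x \<in> {0<..<2 * pi}. ?D x = 0}"
  note ZD = card_dirichlet_factor_zeros[OF \<open>l \<ge> 1\<close> m1]
  have pos: "2 * pi > 0" by simp
  have "AE \<omega> in M. \<forall>x\<in>?ZD. G.process \<omega> x \<noteq> 0"
    using ZD(1) by (intro AE_finite_allI G.AE_process_nonzero)
  with G.expected_zeros(1)[OF pos] AE_space
  have gen: "AE \<omega> in M. finite (?ZT \<omega>) \<and> card (?ZT \<omega>) = (l * m - l) + card (?ZY \<omega>)"
  proof eventually_elim
    case (elim \<omega>)
    have "?ZT \<omega> = ?ZD \<union> ?ZY \<omega>" using elim by (auto simp: zeros_on_def T)
    moreover have "?ZD \<inter> ?ZY \<omega> = {}" using elim by auto
    ultimately show ?case using ZD elim by (simp add: card_Un_disjoint)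
  qed
  \<comment> \<open>The measure need not be complete, so measurability is shown for the number of zeros
    itself and not deduced from the almost sure identity above.\<close>
  have "(\<lambda>\<omega>. real (card {x \<in> {0<..<2 * pi}. ?D x * G.process \<omega> x = 0})) \<in> borel_measurable M"
    by (rule borel_measurable_card_zeros)
       (auto simp: dirichlet_factor_def intro!: continuous_intros G.continuous_process)
  moreover have "real (num_zeros {0<..<2 * pi} (T \<omega>)) = real (card {x \<in> {0<..<2 * pi}. ?D x * G.process \<omega> x = 0})"
    if "\<omega> \<in> space M" for \<omega>
    using that by (simp add: num_zeros_def zeros_on_def T)
  ultimately have meas: "(\<lambda>\<omega>. real (num_zeros {0<..<2 * pi} (T \<omega>))) \<in> borel_measurable M"
    by (simp cong: measurable_cong)
  define E where "E = 2 * pi / pi * sqrt ((\<Sum>j<l. (?\<theta> j)\<^sup>2) / real (card {..<l}))"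
  have E: "E = sqrt ((real n)\<^sup>2 + ((real l)\<^sup>2 - 1) / 3)"
  proof -
    have n: "real n = real l * real m - 1" using \<open>n = l * m - 1\<close> \<open>l \<ge> 1\<close> m1 by (simp add: of_nat_diff)
    have "(\<Sum>j<l. (?\<theta> j)\<^sup>2) / real (card {..<l}) = (real n / 2)\<^sup>2 + ((real l)\<^sup>2 - 1) / 12"
    proof -
      have mean: "real l * (real m - 1) / 2 + (real l - 1) / 2 = real n / 2"
        unfolding n by (simp add: field_simps)
      show ?thesis
        unfolding centred_freq_def sum_shifted_squares mean using \<open>l \<ge> 1\<close> by simp
    qed
    then have "E = sqrt 4 * sqrt ((real n / 2)\<^sup>2 + ((real l)\<^sup>2 - 1) / 12)"
      unfolding E_def by simp
    also have "\<dots> = sqrt (4 * ((real n / 2)\<^sup>2 + ((real l)\<^sup>2 - 1) / 12))"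
      by (rule real_sqrt_mult[symmetric])
    also have "4 * ((real n / 2)\<^sup>2 + ((real l)\<^sup>2 - 1) / 12) = (real n)\<^sup>2 + ((real l)\<^sup>2 - 1) / 3"
      by (simp add: power_divide field_simps)
    finally show ?thesis .
  qed
  have E0: "E \<ge> 0" unfolding E_def by (intro mult_nonneg_nonneg) (auto intro!: divide_nonneg_nonneg sum_nonneg)
  have ZYmeas: "(\<lambda>\<omega>. real (card (?ZY \<omega>))) \<in> borel_measurable M"
    by (rule borel_measurable_card_zeros) (auto intro: G.continuous_process)
  have "(\<integral>\<^sup>+\<omega>. ennreal (real (num_zeros {0<..<2 * pi} (T \<omega>))) \<partial>M) =
    (\<integral>\<^sup>+\<omega>. ennreal (real (l * m - l)) + ennreal (real (card (?ZY \<omega>))) \<partial>M)"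
  proof (rule nn_integral_cong_AE)
    show "AE \<omega> in M. ennreal (real (num_zeros {0<..<2 * pi} (T \<omega>))) =
      ennreal (real (l * m - l)) + ennreal (real (card (?ZY \<omega>)))"
      using gen by eventually_elim (simp add: num_zeros_def ennreal_plus[symmetric] del: ennreal_plus)
  qed
  also have "\<dots> = ennreal (real (l * m - l)) + (\<integral>\<^sup>+\<omega>. ennreal (real (card (?ZY \<omega>))) \<partial>M)"
    using ZYmeas emeasure_space_1 by (subst nn_integral_add) auto
  also have "(\<integral>\<^sup>+\<omega>. ennreal (real (card (?ZY \<omega>))) \<partial>M) = ennreal E"
    using G.expected_zeros(2)[OF pos] by (simp only: E_def ennreal_of_nat_eq_real_of_nat)
  also have "ennreal (real (l * m - l)) + ennreal E = ennreal (real (l * m - l) + E)"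
    using E0 by (simp add: ennreal_plus)
  finally have I: "(\<integral>\<^sup>+\<omega>. ennreal (real (num_zeros {0<..<2 * pi} (T \<omega>))) \<partial>M) = ennreal (real (l * m - l) + E)" .
  have "integrable M (\<lambda>\<omega>. real (num_zeros {0<..<2 * pi} (T \<omega>)))"
    using meas I by (intro integrableI_nonneg) auto
  moreover have "expectation (\<lambda>\<omega>. real (num_zeros {0<..<2 * pi} (T \<omega>))) = real (l * m - l) + E"
    using meas E0 by (subst integral_eq_nn_integral) (simp_all add: I del: ennreal_plus)
  moreover have "real (l * m - l) = real n + 1 - real l"
    using \<open>n = l * m - 1\<close> \<open>l \<ge> 1\<close> m1 by (simp add: of_nat_diff)
  moreover have "AE \<omega> in M. finite (?ZT \<omega>)" using gen by eventually_elim simp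
  ultimately show ?thesis using E by simp
qed

end
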